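(* Let $a=0$ (ReLU activation) and $x^{(0)}\neq0$. Define $$\pi_d(n)=\binom{d}{n}\frac{1}{2^d-1}\quad(1\le n\le d),\qquad \mu_0(\sigma)=\log\sigma+\frac12\sum_{n=1}^d\pi_d(n)\Big[\log 2+\psi_0\big(\tfrac n2\big)\Big],$$ $$s_0^2=\frac14\sum_{n=1}^d\pi_d(n)\Big[\psi_1\big(\tfrac n2\big)+\Big(\log2+\psi_0\big(\tfrac n2\big)\Big)^2\Big]-\frac14\Big(\sum_{n=1}^d\pi_d(n)\Big[\log2+\psi_0\big(\tfrac n2\big)\Big]\Big)^2,$$ where $\psi_0$ is the digamma and $\psi_1$ the trigamma function. Let $R_{k,0}$ be a random variable distributed as $\log\|x^{(k)}\|$ conditionally on the event $\{x^{(k)}\neq0\}$. Then $R_{k,0}/k\to\mu_0(\sigma)$ in probability as $k\to\infty$ (the limit is deterministic and independent of $x^{(0)}$), and $$\frac{R_{k,0}-\mu_0(\sigma)k}{\sqrt k}\Rightarrow\mathcal N(0,s_0^2)\quad\text{in distribution as }k\to\infty.$$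
   Context: Fix an integer width $d\ge1$ and a parameter $a\in[0,1]$. The parametric ReLU $\phi_a:\mathbb{R}\to\mathbb{R}$ is $\phi_a(z)=z$ for $z>0$ and $\phi_a(z)=az$ for $z\le 0$; it is applied componentwise to vectors ($\phi_0$ is ReLU, $\phi_1$ is the identity). Given $\sigma>0$ and a deterministic input $x^{(0)}\in\mathbb{R}^d$, the layer outputs of the fully connected network with zero biases are $x^{(k+1)}=\phi_a(W^{(k+1)}x^{(k)})$, $k\ge0$, where all entries of all matrices $W^{(1)},W^{(2)},\dots\in\mathbb{R}^{d\times d}$ are i.i.d. $\mathcal{N}(0,\sigma^2)$. $\|\cdot\|$ denotes the Euclidean norm. *)

theory Defs
  imports "HOL-Probability.Probability"
begin

definition prelu :: "real \<Rightarrow> real \<Rightarrow> real" where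
  "prelu a z = (if z > 0 then z else a * z)"

text \<open>Weights: omega (k,i,j) is the entry (i,j) of the matrix W^(k+1).
  Layer outputs x^(k) of the zero-bias fully connected network of width CARD('d).\<close>
primrec layer :: "real \<Rightarrow> real^'d \<Rightarrow> (nat \<times> 'd \<times> 'd \<Rightarrow> real) \<Rightarrow> nat \<Rightarrow> real^'d" where
  "layer a x0 \<omega> 0 = x0"
| "layer a x0 \<omega> (Suc k) =
     (\<chi> i. prelu a (\<Sum>j\<in>UNIV. \<omega> (k, i, j) * (layer a x0 \<omega> k $ j)))"

definition weight_space :: "real \<Rightarrow> (nat \<times> 'd::finite \<times> 'd \<Rightarrow> real) measure" where
  "weight_space \<sigma> = PiM UNIV (\<lambda>_. density lborel (normal_density 0 \<sigma>))"

definition R_law :: "real \<Rightarrow> real \<Rightarrow> real^'d::finite \<Rightarrow> nat \<Rightarrow> real measure" where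
  "R_law a \<sigma> x0 k =
     (let M = (weight_space \<sigma> :: (nat \<times> 'd \<times> 'd \<Rightarrow> real) measure);
          E = {\<omega> \<in> space M. layer a x0 \<omega> k \<noteq> 0}
      in distr (density M (\<lambda>\<omega>. ennreal (indicator E \<omega> / measure M E))) borel
               (\<lambda>\<omega>. ln (norm (layer a x0 \<omega> k))))"

definition pi_d :: "nat \<Rightarrow> nat \<Rightarrow> real" where
  "pi_d d n = real (d choose n) / (2 ^ d - 1)"

definition mu0 :: "nat \<Rightarrow> real \<Rightarrow> real" where
  "mu0 d \<sigma> = ln \<sigma> + 1/2 * (\<Sum>n=1..d. pi_d d n * (ln 2 + Digamma (real n / 2)))"

definition s0sq :: "nat \<Rightarrow> real" where
  "s0sq d = 1/4 * (\<Sum>n=1..d. pi_d d n *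
               (Polygamma 1 (real n / 2) + (ln 2 + Digamma (real n / 2))^2))
          - 1/4 * (\<Sum>n=1..d. pi_d d n * (ln 2 + Digamma (real n / 2)))^2"

end

theory Submission
  imports Defs
begin

text \<open>
  If \<open>x \<noteq> 0\<close>, the vector \<open>W x\<close> is Gaussian with covariance \<open>\<sigma>\<^sup>2 \<parallel>x\<parallel>\<^sup>2 I\<close>, so \<open>\<parallel>\<phi>\<^sub>0 (W x)\<parallel>\<^sup>2\<close> is \<open>\<sigma>\<^sup>2 \<parallel>x\<parallel>\<^sup>2\<close>
  times a chi-square variable whose number of degrees of freedom, the number of positive
  coordinates, is binomial with parameters \<open>d\<close> and \<open>1/2\<close>. The multiplicative function
  \<open>r \<mapsto> r\<^sup>i\<^sup>t\<^sup>/\<^sup>2\<close>, extended by 0 at \<open>r = 0\<close>, therefore has an expectation at \<open>\<parallel>x\<^sub>k\<parallel>\<^sup>2\<close> which is multiplied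
  by the same factor \<open>c t\<close> in every layer. Dividing by the survival probability (the case \<open>t = 0\<close>), the
  characteristic function of \<open>R\<^sub>k\<close> is \<open>exp (i t ln \<parallel>x\<^sub>0\<parallel>) (c t / c 0)\<^sup>k\<close>, and \<open>c\<close> is an explicit mixture of
  values of the complex Gamma function. The second-order expansion of this mixture at 0 involves
  the digamma and trigamma values in \<open>mu0\<close> and \<open>s0sq\<close>, and Levy's continuity theorem gives
  the central limit theorem. Convergence in probability follows from it, since weakly convergent
  sequences are tight.
\<close>

subsection \<open>Gamma distributions\<close>

text \<open>The scale is fixed to 1: the factor \<open>2 * \<tau>\<^sup>2\<close> is divided out of
  squared Gaussians before this density appears, so only the shape \<open>a\<close> varies. The
  value 0 is also taken at \<open>x = 0\<close>, so the density ignores an atom there.\<close>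

definition gamma_density :: "real \<Rightarrow> real \<Rightarrow> real" where
  "gamma_density a x = (if x \<le> 0 then 0 else x powr (a - 1) * exp (- x) / Gamma a)"

lemma gamma_density_measurable [measurable]: "gamma_density a \<in> borel_measurable borel"
  unfolding gamma_density_def[abs_def] by measurable

lemma gamma_density_nonneg: "a > 0 \<Longrightarrow> 0 \<le> gamma_density a x"
  by (simp add: gamma_density_def Gamma_real_pos less_imp_le)

lemma nn_integral_gamma_density:
  assumes "a > 0"
  shows "(\<integral>\<^sup>+x. gamma_density a x \<partial>lborel) = 1"
proof -
  have G: "Gamma a > 0" using assms by (rule Gamma_real_pos)
  have "(\<integral>\<^sup>+x. gamma_density a x \<partial>lborel) =
      (\<integral>\<^sup>+x. ennreal (1 / Gamma a) * ennreal (indicator {0..} x * x powr (a - 1) / exp x) \<partial>lborel)"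
    using G by (intro nn_integral_cong)
      (auto simp: gamma_density_def ennreal_mult'[symmetric] exp_minus field_simps split: split_indicator)
  also have "\<dots> = ennreal (1 / Gamma a) * ennreal (Gamma a)"
    by (subst nn_integral_cmult) (simp_all add: Gamma_conv_nn_integral_real[OF assms])
  also have "\<dots> = 1" using G by (simp add: ennreal_mult'[symmetric])
  finally show ?thesis .
qed

lemma prob_space_gamma_density: "a > 0 \<Longrightarrow> prob_space (density lborel (gamma_density a))"
  by (rule prob_spaceI) (simp add: emeasure_density nn_integral_gamma_density)

text \<open>Scaling shows that the convolution is a constant multiple of the density with parameter
  \<open>a + b\<close>; the constant, a Beta integral, is 1 because both sides are probability densities.\<close>
lemma convolution_gamma_density:
  assumes a: "a > 0" and b: "b > 0"
  shows "density lborel (gamma_density a) \<star> density lborel (gamma_density b) =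
         density lborel (gamma_density (a + b))"
proof -
  interpret A: prob_space "density lborel (gamma_density a)" by (rule prob_space_gamma_density[OF a])
  interpret B: prob_space "density lborel (gamma_density b)" by (rule prob_space_gamma_density[OF b])
  define K where "K x = (\<integral>\<^sup>+y. ennreal (gamma_density a (x - y)) * ennreal (gamma_density b y) \<partial>lborel)" for x
  define C where "C = (\<integral>\<^sup>+u. ennreal (Gamma (a + b) / (Gamma a * Gamma b) *
       (indicator {0<..<1} u * (1 - u) powr (a - 1) * u powr (b - 1))) \<partial>lborel)"
  have G: "Gamma a > 0" "Gamma b > 0" "Gamma (a + b) > 0" using a b by (auto intro: Gamma_real_pos)
  have conv: "density lborel (gamma_density a) \<star> density lborel (gamma_density b) = density lborel K"
    unfolding K_def by (rule convolution_density) (auto intro: A.finite_measure_axioms B.finite_measure_axioms)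
  have K: "K x = ennreal (gamma_density (a + b) x) * C" for x
  proof (cases "x \<le> 0")
    case True
    have "K x = (\<integral>\<^sup>+(y::real). 0 \<partial>lborel)"
      unfolding K_def by (intro nn_integral_cong) (use True in \<open>auto simp: gamma_density_def\<close>)
    with True show ?thesis by (simp add: gamma_density_def)
  next
    case False
    then have x: "x > 0" by simp
    \<comment> \<open>The substitution \<open>y = x * u\<close> moves all dependence on
      \<open>x\<close> into a power of \<open>x\<close> and \<open>exp (- x)\<close>; what remains
      is the \<open>x\<close>-free integral \<open>C\<close> over the unit interval.\<close>
    have "K x = ennreal \<bar>x\<bar> * (\<integral>\<^sup>+u. ennreal (gamma_density a (x - (0 + x * u))) *
        ennreal (gamma_density b (0 + x * u)) \<partial>lborel)"
      unfolding K_def using x by (subst nn_integral_real_affine[where c = x and t = 0]) auto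
    also have "\<dots> = (\<integral>\<^sup>+u. ennreal x * (ennreal (gamma_density a (x - (0 + x * u))) *
        ennreal (gamma_density b (0 + x * u))) \<partial>lborel)"
      using x by (subst nn_integral_cmult) auto
    also have "\<dots> = (\<integral>\<^sup>+u. ennreal (gamma_density (a + b) x) * ennreal (Gamma (a + b) / (Gamma a * Gamma b) *
       (indicator {0<..<1} u * (1 - u) powr (a - 1) * u powr (b - 1))) \<partial>lborel)"
    proof (intro nn_integral_cong)
      fix u :: real
      show "ennreal x * (ennreal (gamma_density a (x - (0 + x * u))) * ennreal (gamma_density b (0 + x * u)))
        = ennreal (gamma_density (a + b) x) * ennreal (Gamma (a + b) / (Gamma a * Gamma b) *
           (indicator {0<..<1} u * (1 - u) powr (a - 1) * u powr (b - 1)))"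
      proof (cases "0 < u \<and> u < 1")
        case True
        then have u: "x * u > 0" "x - x * u > 0" using x by auto
        have e1: "x - x * u = x * (1 - u)" by (simp add: algebra_simps)
        have e2: "x powr (a + b - 1) = x * x powr (a - 1) * x powr (b - 1)"
        proof -
          have "x powr (a + b - 1) = x powr (1 + (a - 1) + (b - 1))" by (simp add: algebra_simps)
          also have "\<dots> = x * x powr (a - 1) * x powr (b - 1)"
            unfolding powr_add using x by simp
          finally show ?thesis .
        qed
        have e3: "exp (- (x - x * u)) * exp (- (x * u)) = exp (- x)"
          by (simp add: exp_add[symmetric])
        have "x * (gamma_density a (x - x * u) * gamma_density b (x * u)) =
          x * ((x * (1 - u)) powr (a - 1) * (x * u) powr (b - 1)) * (exp (- (x - x * u)) * exp (- (x * u))) / (Gamma a * Gamma b)"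
          using u unfolding gamma_density_def by (simp add: e1)
        also have "\<dots> = x powr (a + b - 1) * ((1 - u) powr (a - 1) * u powr (b - 1)) * exp (- x) / (Gamma a * Gamma b)"
          unfolding e3 e2 using True x by (simp add: powr_mult)
        also have "\<dots> = gamma_density (a + b) x * (Gamma (a + b) / (Gamma a * Gamma b) *
           (indicator {0<..<1} u * (1 - u) powr (a - 1) * u powr (b - 1)))"
          using True x G by (simp add: gamma_density_def)
        finally show ?thesis
          using x a b G by (simp add: ennreal_mult'[symmetric] ennreal_mult''[symmetric] gamma_density_nonneg)
      next
        case False
        then have "x * u \<le> 0 \<or> x - x * u \<le> 0" using x
          by (auto simp: mult_le_0_iff)
        then have "ennreal (gamma_density a (x - (0 + x * u))) * ennreal (gamma_density b (0 + x * u)) = 0"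
          by (auto simp: gamma_density_def)
        with False show ?thesis by auto
      qed
    qed
    also have "\<dots> = ennreal (gamma_density (a + b) x) * C"
      unfolding C_def by (subst nn_integral_cmult) auto
    finally show ?thesis .
  qed
  interpret D: prob_space "density lborel K"
    using prob_space_convolution_density[of "\<lambda>x. ennreal (gamma_density a x)" "\<lambda>x. ennreal (gamma_density b x)"]
      A.prob_space_axioms B.prob_space_axioms
    by (simp add: K_def[abs_def])
  have Km: "K \<in> borel_measurable borel" unfolding K_def by measurable
  have "1 = (\<integral>\<^sup>+x. K x \<partial>lborel)"
    using D.emeasure_space_1 Km by (simp add: emeasure_density)
  also have "\<dots> = C"
    unfolding K using a b by (subst nn_integral_multc) (auto simp: nn_integral_gamma_density)
  finally have "K = (\<lambda>x. ennreal (gamma_density (a + b) x))" by (simp add: K fun_eq_iff)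
  then show ?thesis unfolding conv by simp
qed

text \<open>Both sides are increasing suprema of integrals over compact intervals, by monotone
  convergence, and on each of those the usual substitution rule applies. The right end
  \<open>Suc n\<close> keeps \<open>{0..Suc n}\<close> nondegenerate for every \<open>n\<close>.
  Only \<open>g' \<ge> 0\<close> is assumed, because the later substitution by a square has
  derivative 0 at the left end.\<close>

lemma nn_integral_substitution_atLeast_0:
  fixes f :: "real \<Rightarrow> ennreal" and g g' :: "real \<Rightarrow> real"
  assumes f [measurable]: "f \<in> borel_measurable borel"
    and deriv: "\<And>x. x \<ge> 0 \<Longrightarrow> (g has_real_derivative g' x) (at x)"
    and cont: "continuous_on {0..} g'"
    and nonneg: "\<And>x. x \<ge> 0 \<Longrightarrow> g' x \<ge> 0"
    and lim: "filterlim g at_top at_top"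
    and [measurable]: "g \<in> borel_measurable borel" "g' \<in> borel_measurable borel"
  shows "(\<integral>\<^sup>+x. f x * indicator {g 0..} x \<partial>lborel) = (\<integral>\<^sup>+x. f (g x) * g' x * indicator {0..} x \<partial>lborel)"
proof -
  have gmono: "g x \<le> g y" if "0 \<le> x" "x \<le> y" for x y
    using DERIV_nonneg_imp_nondecreasing[of x y g] deriv nonneg that by (meson order_trans)
  have L: "(\<integral>\<^sup>+x. f x * indicator {g 0..} x \<partial>lborel) = (SUP n. \<integral>\<^sup>+x. f x * indicator {g 0..g (real (Suc n))} x \<partial>lborel)"
  proof -
    have "(\<integral>\<^sup>+x. f x * indicator {g 0..} x \<partial>lborel) = (\<integral>\<^sup>+x. (SUP n. f x * indicator {g 0..g (real (Suc n))} x) \<partial>lborel)"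
    proof (intro nn_integral_cong antisym)
      fix x :: real
      show "f x * indicator {g 0..} x \<le> (SUP n. f x * indicator {g 0..g (real (Suc n))} x)"
      proof (cases "g 0 \<le> x")
        case True
        have "filterlim (\<lambda>n. g (real (Suc n))) at_top sequentially"
          by (rule filterlim_compose[OF lim])
             (rule filterlim_compose[OF filterlim_real_sequentially filterlim_Suc])
        then obtain n where "x \<le> g (real (Suc n))"
          by (auto simp: filterlim_at_top eventually_sequentially)
        with True show ?thesis by (intro SUP_upper2[of n]) auto
      qed simp
      show "(SUP n. f x * indicator {g 0..g (real (Suc n))} x) \<le> f x * indicator {g 0..} x"
        by (rule SUP_least) (auto split: split_indicator)
    qed
    also have "\<dots> = (SUP n. \<integral>\<^sup>+x. f x * indicator {g 0..g (real (Suc n))} x \<partial>lborel)"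
    proof (rule nn_integral_monotone_convergence_SUP)
      have "g (real (Suc n)) \<le> g (real (Suc m))" if "n \<le> m" for n m by (rule gmono) (use that in auto)
      then show "incseq (\<lambda>n x. f x * indicator {g 0..g (real (Suc n))} x)"
        by (auto simp: incseq_def le_fun_def split: split_indicator) (meson order_trans)+
    qed measurable
    finally show ?thesis .
  qed
  have R: "(\<integral>\<^sup>+x. f (g x) * g' x * indicator {0..} x \<partial>lborel) = (SUP n. \<integral>\<^sup>+x. f (g x) * g' x * indicator {0..real (Suc n)} x \<partial>lborel)"
  proof -
    have "(\<integral>\<^sup>+x. f (g x) * g' x * indicator {0..} x \<partial>lborel) =
        (\<integral>\<^sup>+x. (SUP n. f (g x) * g' x * indicator {0..real (Suc n)} x) \<partial>lborel)"
    proof (intro nn_integral_cong antisym)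
      fix x :: real
      show "f (g x) * g' x * indicator {0..} x \<le> (SUP n. f (g x) * g' x * indicator {0..real (Suc n)} x)"
      proof (cases "0 \<le> x")
        case True
        obtain n where "x \<le> real n" using real_arch_simple by blast
        with True show ?thesis by (intro SUP_upper2[of n]) auto
      qed simp
      show "(SUP n. f (g x) * g' x * indicator {0..real (Suc n)} x) \<le> f (g x) * g' x * indicator {0..} x"
        by (rule SUP_least) (auto split: split_indicator)
    qed
    also have "\<dots> = (SUP n. \<integral>\<^sup>+x. f (g x) * g' x * indicator {0..real (Suc n)} x \<partial>lborel)"
      by (rule nn_integral_monotone_convergence_SUP)
         (auto simp: incseq_def le_fun_def split: split_indicator)
    finally show ?thesis .
  qed
  have "(\<integral>\<^sup>+x. f x * indicator {g 0..g (real (Suc n))} x \<partial>lborel) =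
     (\<integral>\<^sup>+x. f (g x) * g' x * indicator {0..real (Suc n)} x \<partial>lborel)" for n
    by (rule nn_integral_substitution_aux)
       (auto intro: deriv nonneg continuous_on_subset[OF cont])
  then show ?thesis unfolding L R by simp
qed

text \<open>By symmetry the positive part is 0 with probability 1/2, which gives the term
  \<open>f 0\<close>. On the positive half-line the substitution
  \<open>x = u\<^sup>2 / (2 * \<tau>\<^sup>2)\<close> turns the Gaussian density into half of the
  Gamma density of shape 1/2.\<close>

lemma nn_integral_normal_pos_part_square:
  fixes f :: "real \<Rightarrow> ennreal"
  assumes [measurable]: "f \<in> borel_measurable borel" and \<tau>: "\<tau> > 0"
  shows "(\<integral>\<^sup>+u. f ((max 0 u)\<^sup>2 / (2 * \<tau>\<^sup>2)) \<partial>density lborel (normal_density 0 \<tau>)) =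
    ennreal (1/2) * f 0 + ennreal (1/2) * (\<integral>\<^sup>+x. f x \<partial>density lborel (gamma_density (1/2)))"
proof -
  let ?N = "normal_density 0 \<tau>"
  have half: "(\<integral>\<^sup>+u. ennreal (?N u) * indicator {..<0} u \<partial>lborel) = ennreal (1/2)"
  proof -
    have refl: "(\<integral>\<^sup>+u. ennreal (?N u) * indicator {..<0} u \<partial>lborel) = (\<integral>\<^sup>+u. ennreal (?N u) * indicator {0<..} u \<partial>lborel)"
      by (subst nn_integral_real_affine[where c = "-1" and t = 0])
         (auto intro!: nn_integral_cong simp: normal_density_def split: split_indicator)
    interpret prob_space "density lborel ?N" by (rule prob_space_normal_density[OF \<tau>])
    have "1 = (\<integral>\<^sup>+u. ennreal (?N u) \<partial>lborel)"
      using emeasure_space_1 by (simp add: emeasure_density)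
    also have "\<dots> = (\<integral>\<^sup>+u. ennreal (?N u) * indicator {..<0} u + ennreal (?N u) * indicator {0<..} u \<partial>lborel)"
      by (intro nn_integral_cong_AE AE_I[where N = "{0}"]) (auto split: split_indicator)
    also have "\<dots> = 2 * (\<integral>\<^sup>+u. ennreal (?N u) * indicator {..<0} u \<partial>lborel)"
      by (subst nn_integral_add) (auto simp: refl mult_2)
    finally have "(\<integral>\<^sup>+u. ennreal (?N u) * indicator {..<0} u \<partial>lborel) * 2 = 1" by (simp add: mult.commute)
    moreover have "(2::ennreal) * ennreal (1/2) = 1"
      using ennreal_mult'[of 2 "1/2"] by (simp del: ennreal_half)
    ultimately show ?thesis by (metis mult.assoc mult_1 mult_1_right)
  qed
  let ?g = "\<lambda>u::real. u\<^sup>2 / (2 * \<tau>\<^sup>2)" and ?g' = "\<lambda>u::real. u / \<tau>\<^sup>2"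
  \<comment> \<open>The factor 1/2 is built into the integrand because the pulled-back Gamma density
    is twice the normal density on \<open>u > 0\<close>.\<close>
  have sub: "(\<integral>\<^sup>+x. (ennreal (1/2) * (ennreal (gamma_density (1/2) x) * f x)) * indicator {?g 0..} x \<partial>lborel) =
    (\<integral>\<^sup>+u. (ennreal (1/2) * (ennreal (gamma_density (1/2) (?g u)) * f (?g u))) * ?g' u * indicator {0..} u \<partial>lborel)"
  proof (rule nn_integral_substitution_atLeast_0)
    show "(?g has_real_derivative ?g' x) (at x)" for x
      using \<tau> by (auto intro!: derivative_eq_intros simp: field_simps)
    show "filterlim ?g at_top at_top"
    proof -
      have "filterlim (\<lambda>u::real. (1 / (2 * \<tau>\<^sup>2)) * u ^ 2) at_top at_top"
        using \<tau> by (intro filterlim_tendsto_pos_mult_at_top[OF tendsto_const] filterlim_pow_at_top filterlim_ident) auto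
      then show ?thesis by simp
    qed
  qed (use \<tau> in \<open>auto intro!: continuous_intros\<close>)
  have pt: "ennreal (1/2) * (ennreal (gamma_density (1/2) (?g u)) * f (?g u)) * ?g' u * indicator {0..} u
      = ennreal (?N u) * f (?g u) * indicator {0<..} u" for u
  proof (cases "u > 0")
    case True
    have pw: "(u\<^sup>2 / (2 * \<tau>\<^sup>2)) powr (1/2 - 1) = sqrt 2 * \<tau> / u"
    proof -
      have "(u\<^sup>2 / (2 * \<tau>\<^sup>2)) powr (1/2 - 1) = 1 / (u\<^sup>2 / (2 * \<tau>\<^sup>2)) powr (1/2)"
        by (simp add: powr_minus_divide[symmetric])
      also have "\<dots> = 1 / sqrt (u\<^sup>2 / (2 * \<tau>\<^sup>2))" by (simp add: powr_half_sqrt)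
      also have "\<dots> = sqrt 2 * \<tau> / u" using True \<tau> by (simp add: real_sqrt_divide real_sqrt_mult)
      finally show ?thesis .
    qed
    have "1/2 * gamma_density (1/2) (?g u) * ?g' u = ?N u"
      using True \<tau> unfolding gamma_density_def normal_density_def pw
      by (simp add: Gamma_one_half_real real_sqrt_mult field_simps power2_eq_square)
         (simp add: real_sqrt_mult_self power2_eq_square[symmetric] mult.assoc[symmetric])
    then have "ennreal (?N u) = ennreal (1/2) * ennreal (gamma_density (1/2) (?g u)) * ennreal (?g' u)"
      using True \<tau> ennreal_mult[of "1/2 * gamma_density (1/2) (?g u)" "?g' u"]
        ennreal_mult[of "1/2" "gamma_density (1/2) (?g u)"] by (simp add: gamma_density_nonneg)
    with True show ?thesis by (simp add: mult_ac)
  next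
    case False
    then show ?thesis by (cases "u = 0") (auto split: split_indicator)
  qed
  have "(\<integral>\<^sup>+u. f ((max 0 u)\<^sup>2 / (2 * \<tau>\<^sup>2)) \<partial>density lborel ?N) =
     (\<integral>\<^sup>+u. f ((max 0 u)\<^sup>2 / (2 * \<tau>\<^sup>2)) * ennreal (?N u) \<partial>lborel)"
    by (subst nn_integral_density) (auto simp: mult.commute)
  also have "\<dots> = (\<integral>\<^sup>+u. f 0 * (ennreal (?N u) * indicator {..<0} u) + ennreal (?N u) * f (?g u) * indicator {0<..} u \<partial>lborel)"
    by (intro nn_integral_cong_AE AE_I[where N = "{0}"]) (auto split: split_indicator simp: max_def mult.commute)
  also have "\<dots> = f 0 * ennreal (1/2) + (\<integral>\<^sup>+u. ennreal (?N u) * f (?g u) * indicator {0<..} u \<partial>lborel)"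
    by (subst nn_integral_add) (auto simp: nn_integral_cmult half)
  also have "(\<integral>\<^sup>+u. ennreal (?N u) * f (?g u) * indicator {0<..} u \<partial>lborel) =
     (\<integral>\<^sup>+x. ennreal (1/2) * (ennreal (gamma_density (1/2) x) * f x) * indicator {?g 0..} x \<partial>lborel)"
    unfolding sub pt ..
  also have "\<dots> = (\<integral>\<^sup>+x. ennreal (1/2) * (ennreal (gamma_density (1/2) x) * f x) \<partial>lborel)"
    by (intro nn_integral_cong) (auto simp: gamma_density_def split: split_indicator)
  also have "\<dots> = ennreal (1/2) * (\<integral>\<^sup>+x. f x \<partial>density lborel (gamma_density (1/2)))"
    by (subst nn_integral_cmult) (auto simp: nn_integral_density)
  finally show ?thesis by (simp add: mult.commute)
qed

subsection \<open>Squared norms of rectified Gaussian vectors\<close>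

text \<open>The law of half of a chi-square variable with \<open>n\<close> degrees of freedom; at \<open>n = 0\<close> the
  density formula would be junk, and the law is a point mass.\<close>
definition half_gamma :: "nat \<Rightarrow> real measure" where
  "half_gamma n = (if n = 0 then return borel 0 else density lborel (gamma_density (real n / 2)))"

lemma sets_half_gamma [simp, measurable_cong]: "sets (half_gamma n) = sets borel"
  by (simp add: half_gamma_def)

lemma prob_space_half_gamma: "prob_space (half_gamma n)"
  by (auto simp: half_gamma_def intro!: prob_space_return prob_space_gamma_density)

text \<open>Shapes add under convolution, and for \<open>n = 0\<close> the point mass at 0 is
  neutral. The iterated integral is the shape in which the sum arises when coordinates are added one
  at a time.\<close>

lemma nn_integral_half_gamma_Suc:
  assumes [measurable]: "f \<in> borel_measurable borel"
  shows "(\<integral>\<^sup>+x. \<integral>\<^sup>+y. f (x + y) \<partial>half_gamma 1 \<partial>half_gamma n) = (\<integral>\<^sup>+x. f x \<partial>half_gamma (Suc n))"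
proof (cases "n = 0")
  case True
  interpret prob_space "half_gamma 1" by (rule prob_space_half_gamma)
  have "(\<lambda>x. \<integral>\<^sup>+y. f (x + y) \<partial>half_gamma 1) \<in> borel_measurable borel" by measurable
  then have "(\<integral>\<^sup>+x. \<integral>\<^sup>+y. f (x + y) \<partial>half_gamma 1 \<partial>return borel 0) = (\<integral>\<^sup>+y. f (0 + y) \<partial>half_gamma 1)"
    by (subst nn_integral_return) auto
  with True show ?thesis by (simp add: half_gamma_def)
next
  case False
  interpret P: prob_space "half_gamma 1" by (rule prob_space_half_gamma)
  interpret Q: prob_space "half_gamma n" by (rule prob_space_half_gamma)
  have "half_gamma (Suc n) = (half_gamma n \<star> half_gamma 1)"
    using False convolution_gamma_density[of "real n / 2" "1/2"]
    by (simp add: half_gamma_def add_divide_distrib add.commute)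
  then show ?thesis
    by (simp add: nn_integral_convolution P.finite_measure_axioms Q.finite_measure_axioms del: One_nat_def)
qed

text \<open>Pascal's rule in summed form: a new coordinate either leaves the number \<open>n\<close>
  of positive coordinates alone or raises it to \<open>Suc n\<close>.\<close>

lemma sum_choose_Suc:
  fixes F :: "nat \<Rightarrow> 'a::comm_semiring_1"
  shows "(\<Sum>n\<le>Suc m. of_nat (Suc m choose n) * F n) = (\<Sum>n\<le>m. of_nat (m choose n) * (F n + F (Suc n)))"
proof -
  have "(\<Sum>n\<le>m. of_nat (m choose n) * F n) = (\<Sum>n\<le>Suc m. of_nat (m choose n) * F n)"
    by (simp add: binomial_eq_0)
  also have "\<dots> = F 0 + (\<Sum>n\<le>m. of_nat (m choose Suc n) * F (Suc n))"
    by (subst sum.atMost_Suc_shift) simp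
  finally have "(\<Sum>n\<le>m. of_nat (m choose n) * (F n + F (Suc n))) =
     F 0 + (\<Sum>n\<le>m. of_nat (m choose Suc n) * F (Suc n)) + (\<Sum>n\<le>m. of_nat (m choose n) * F (Suc n))"
    by (simp add: distrib_left sum.distrib)
  also have "\<dots> = (\<Sum>n\<le>Suc m. of_nat (Suc m choose n) * F n)"
    by (subst sum.atMost_Suc_shift) (simp add: distrib_right sum.distrib algebra_simps)
  finally show ?thesis ..
qed

text \<open>Each coordinate contributes 0 or an independent Gamma variable of shape 1/2, with
  probability 1/2 each, so the number of nonzero contributions is binomial. The induction varies
  \<open>f\<close>, since integrating out one coordinate replaces \<open>f\<close> by an average of
  its translates.\<close>

lemma nn_integral_sum_pos_part_square:
  fixes f :: "real \<Rightarrow> ennreal"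
  assumes "finite I" and f: "f \<in> borel_measurable borel" and \<tau>: "\<tau> > 0"
  shows "(\<integral>\<^sup>+\<omega>. f (\<Sum>i\<in>I. (max 0 (\<omega> i))\<^sup>2 / (2 * \<tau>\<^sup>2)) \<partial>PiM I (\<lambda>_. density lborel (normal_density 0 \<tau>))) =
    ennreal (1/2) ^ card I * (\<Sum>n\<le>card I. of_nat (card I choose n) * (\<integral>\<^sup>+x. f x \<partial>half_gamma n))"
  using \<open>finite I\<close> f
proof (induction I arbitrary: f)
  case empty
  then show ?case by (simp add: half_gamma_def nn_integral_return PiM_empty nn_integral_count_space_finite)
next
  case (insert i I)
  note [measurable] = insert.prems
  let ?N = "density lborel (normal_density 0 \<tau>)"
  interpret N: prob_space ?N by (rule prob_space_normal_density[OF \<tau>])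
  interpret product_sigma_finite "\<lambda>_::'a. ?N" ..
  interpret P: prob_space "half_gamma 1" by (rule prob_space_half_gamma)
  \<comment> \<open>The conditional expectation over the new coordinate when the other coordinates
    sum to \<open>s\<close>.\<close>
  define h where "h s = ennreal (1/2) * f s + ennreal (1/2) * (\<integral>\<^sup>+x. f (s + x) \<partial>half_gamma 1)" for s
  have h [measurable]: "h \<in> borel_measurable borel" unfolding h_def by measurable
  have "(\<integral>\<^sup>+\<omega>. f (\<Sum>j\<in>insert i I. (max 0 (\<omega> j))\<^sup>2 / (2 * \<tau>\<^sup>2)) \<partial>PiM (insert i I) (\<lambda>_. ?N)) =
    (\<integral>\<^sup>+\<omega>. (\<integral>\<^sup>+y. f (\<Sum>j\<in>insert i I. (max 0 (fun_upd \<omega> i y j))\<^sup>2 / (2 * \<tau>\<^sup>2)) \<partial>?N) \<partial>PiM I (\<lambda>_. ?N))"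
    using insert.hyps by (intro product_nn_integral_insert) auto
  also have "\<dots> = (\<integral>\<^sup>+\<omega>. h (\<Sum>j\<in>I. (max 0 (\<omega> j))\<^sup>2 / (2 * \<tau>\<^sup>2)) \<partial>PiM I (\<lambda>_. ?N))"
  proof (intro nn_integral_cong)
    fix \<omega> :: "'a \<Rightarrow> real"
    let ?s = "\<Sum>j\<in>I. (max 0 (\<omega> j))\<^sup>2 / (2 * \<tau>\<^sup>2)"
    have "(\<Sum>j\<in>insert i I. (max 0 (fun_upd \<omega> i y j))\<^sup>2 / (2 * \<tau>\<^sup>2)) = ?s + (max 0 y)\<^sup>2 / (2 * \<tau>\<^sup>2)" for y
    proof -
      have "(\<Sum>j\<in>I. (max 0 (fun_upd \<omega> i y j))\<^sup>2 / (2 * \<tau>\<^sup>2)) = ?s"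
        using insert.hyps by (intro sum.cong) auto
      then show ?thesis using insert.hyps by simp
    qed
    then show "(\<integral>\<^sup>+y. f (\<Sum>j\<in>insert i I. (max 0 (fun_upd \<omega> i y j))\<^sup>2 / (2 * \<tau>\<^sup>2)) \<partial>?N) = h ?s"
      using nn_integral_normal_pos_part_square[of "\<lambda>z. f (?s + z)", OF _ \<tau>]
      by (simp add: h_def half_gamma_def)
  qed
  also have "\<dots> = ennreal (1/2) ^ card I * (\<Sum>n\<le>card I. of_nat (card I choose n) * (\<integral>\<^sup>+x. h x \<partial>half_gamma n))"
    by (rule insert.IH) measurable
  also have "(\<lambda>n. \<integral>\<^sup>+x. h x \<partial>half_gamma n) = (\<lambda>n. ennreal (1/2) * ((\<integral>\<^sup>+x. f x \<partial>half_gamma n) + (\<integral>\<^sup>+x. f x \<partial>half_gamma (Suc n))))"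
    unfolding h_def
    by (subst nn_integral_add) (auto simp: nn_integral_cmult nn_integral_half_gamma_Suc[OF insert.prems] distrib_left simp del: One_nat_def)
  also have "ennreal (1/2) ^ card I * (\<Sum>n\<le>card I. of_nat (card I choose n) *
       (ennreal (1/2) * ((\<integral>\<^sup>+x. f x \<partial>half_gamma n) + (\<integral>\<^sup>+x. f x \<partial>half_gamma (Suc n))))) =
    ennreal (1/2) ^ Suc (card I) * (\<Sum>n\<le>card I. of_nat (card I choose n) *
       ((\<integral>\<^sup>+x. f x \<partial>half_gamma n) + (\<integral>\<^sup>+x. f x \<partial>half_gamma (Suc n))))"
    by (simp add: sum_distrib_left mult_ac)
  also have "\<dots> = ennreal (1/2) ^ Suc (card I) * (\<Sum>n\<le>Suc (card I). of_nat (Suc (card I) choose n) * (\<integral>\<^sup>+x. f x \<partial>half_gamma n))"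
    by (simp only: sum_choose_Suc)
  finally show ?case using insert.hyps by simp
qed

text \<open>With \<open>r = x\<^sup>2\<close> this is \<open>exp (i t ln \<bar>x\<bar>)\<close>; the value 0 at \<open>r = 0\<close> restricts an expectation
  to the event \<open>r \<noteq> 0\<close> and keeps the function multiplicative.\<close>
definition logchar :: "real \<Rightarrow> real \<Rightarrow> complex" where
  "logchar t r = (if r = 0 then 0 else iexp (t / 2 * ln r))"

lemma logchar_measurable [measurable]: "logchar t \<in> borel_measurable borel"
  unfolding logchar_def[abs_def] by measurable

lemma norm_logchar: "norm (logchar t r) \<le> 1"
  by (simp add: logchar_def)

lemma logchar_mult: "r \<ge> 0 \<Longrightarrow> s \<ge> 0 \<Longrightarrow> logchar t (r * s) = logchar t r * logchar t s"
  by (auto simp: logchar_def ln_mult exp_add[symmetric] algebra_simps add_divide_distrib)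

text \<open>On \<open>x > 0\<close> the function \<open>logchar t x\<close> is the complex power of
  \<open>x\<close> with exponent \<open>i t / 2\<close>, so the integral is Euler's integral for the
  Gamma function at \<open>a + i t / 2\<close>. Integrability follows from
  \<open>norm_logchar\<close>.\<close>

lemma integral_gamma_density_logchar:
  assumes a: "a > 0"
  shows "integrable lborel (\<lambda>x. gamma_density a x *\<^sub>R logchar t x)"
    and "(\<integral>x. gamma_density a x *\<^sub>R logchar t x \<partial>lborel) = Gamma (of_real a + \<i> * of_real t / 2) / of_real (Gamma a)"
proof -
  have gi: "integrable lborel (gamma_density a)"
    using nn_integral_gamma_density[OF a] gamma_density_nonneg[OF a]
    by (intro integrableI_nonneg) auto
  show int: "integrable lborel (\<lambda>x. gamma_density a x *\<^sub>R logchar t x)"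
    by (rule Bochner_Integration.integrable_bound[OF gi])
       (auto intro!: mult_left_le norm_logchar simp: norm_mult[symmetric])
  let ?z = "of_real a + \<i> * of_real t / 2 :: complex"
  \<comment> \<open>The Lebesgue integral and Euler's integral are compared as gauge integrals over
    the whole line, whose value is unique.\<close>
  have "((\<lambda>x. gamma_density a x *\<^sub>R logchar t x) has_integral (\<integral>x. gamma_density a x *\<^sub>R logchar t x \<partial>lborel)) UNIV"
    by (rule has_integral_integral_lborel[OF int])
  moreover have "((\<lambda>x. gamma_density a x *\<^sub>R logchar t x) has_integral Gamma ?z / of_real (Gamma a)) UNIV"
  proof -
    have "((\<lambda>x. of_real x powr (?z - 1) / of_real (exp x)) has_integral Gamma ?z) {0<..}"
      by (rule Gamma_integral_complex') (use a in simp)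
    then have "((\<lambda>x. of_real x powr (?z - 1) / of_real (exp x) / of_real (Gamma a)) has_integral Gamma ?z / of_real (Gamma a)) {0<..}"
      by (rule has_integral_divide)
    then have "((\<lambda>x. gamma_density a x *\<^sub>R logchar t x) has_integral Gamma ?z / of_real (Gamma a)) {0<..}"
    proof (rule has_integral_eq[rotated])
      fix x :: real assume "x \<in> {0<..}"
      then have x: "x > 0" by simp
      have "complex_of_real x powr (?z - 1) = exp (of_real ((a - 1) * ln x) + \<i> * of_real (t / 2 * ln x))"
        using x by (simp add: powr_def Ln_of_real algebra_simps)
      also have "\<dots> = of_real (x powr (a - 1)) * logchar t x"
        unfolding exp_add exp_of_real using x by (simp add: powr_def logchar_def)
      finally show "of_real x powr (?z - 1) / of_real (exp x) / of_real (Gamma a) = gamma_density a x *\<^sub>R logchar t x"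
        using x by (simp add: gamma_density_def scaleR_conv_of_real exp_minus field_simps)
    qed
    moreover have "(\<lambda>x. if x \<in> {0<..} then gamma_density a x *\<^sub>R logchar t x else 0) = (\<lambda>x. gamma_density a x *\<^sub>R logchar t x)"
      by (auto simp: gamma_density_def)
    ultimately show ?thesis
      using has_integral_restrict_UNIV[of "{0<..}" "\<lambda>x. gamma_density a x *\<^sub>R logchar t x"] by metis
  qed
  ultimately show "(\<integral>x. gamma_density a x *\<^sub>R logchar t x \<partial>lborel) = Gamma ?z / of_real (Gamma a)"
    by (rule has_integral_unique)
qed

text \<open>The expectation of \<open>logchar t\<close> of half a chi-square variable whose number of degrees of
  freedom is binomial with parameters \<open>d\<close> and \<open>1/2\<close>.\<close>
definition gamma_mix :: "nat \<Rightarrow> real \<Rightarrow> complex" where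
  "gamma_mix d t = (\<Sum>n=1..d. of_real (real (d choose n) / 2 ^ d) *
     (Gamma (of_real (real n / 2) + \<i> * of_real t / 2) / of_real (Gamma (real n / 2))))"

text \<open>The mixture formula for nonnegative functions identifies the law of the normalized sum
  away from 0 as the measure with density \<open>h\<close>. This carries it over to the
  complex-valued \<open>logchar t\<close>, which does not see the atom at 0. Multiplicativity then
  restores the scale \<open>2 * \<tau>\<^sup>2\<close>.\<close>

lemma expectation_logchar_sum_pos_part_square:
  assumes I: "finite I" and \<tau>: "\<tau> > 0"
  shows "(\<integral>\<omega>. logchar t (\<Sum>i\<in>I. (max 0 (\<omega> i))\<^sup>2) \<partial>PiM I (\<lambda>_. density lborel (normal_density 0 \<tau>))) =
    logchar t (2 * \<tau>\<^sup>2) * gamma_mix (card I) t"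
proof -
  let ?P = "PiM I (\<lambda>_. density lborel (normal_density 0 \<tau>))"
  let ?S = "\<lambda>\<omega>. \<Sum>i\<in>I. (max 0 (\<omega> i))\<^sup>2 / (2 * \<tau>\<^sup>2)"
  let ?D = "distr ?P borel ?S"
  define h where "h x = (\<Sum>n=1..card I. real (card I choose n) / 2 ^ card I * gamma_density (real n / 2) x)" for x
  have hm [measurable]: "h \<in> borel_measurable borel" unfolding h_def by measurable
  have h0: "0 \<le> h x" for x unfolding h_def by (intro sum_nonneg mult_nonneg_nonneg gamma_density_nonneg) auto
  have Sm [measurable]: "?S \<in> borel_measurable ?P" by measurable
  have eq: "density ?D (\<lambda>x. ennreal (indicator (-{0}) x)) = density lborel (\<lambda>x. ennreal (h x))"
  proof (rule measure_eqI)
    fix A assume "A \<in> sets (density ?D (\<lambda>x. ennreal (indicator (-{0}) x)))"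
    then have A [measurable]: "A \<in> sets borel" by simp
    define f :: "real \<Rightarrow> ennreal" where "f x = indicator (A - {0}) x" for x
    have fm [measurable]: "f \<in> borel_measurable borel" unfolding f_def by measurable
    have "emeasure (density ?D (\<lambda>x. ennreal (indicator (-{0}) x))) A = (\<integral>\<^sup>+x. f x \<partial>?D)"
      by (subst emeasure_density) (auto simp: f_def intro!: nn_integral_cong split: split_indicator)
    also have "\<dots> = (\<integral>\<^sup>+\<omega>. f (?S \<omega>) \<partial>?P)"
      by (subst nn_integral_distr) auto
    also have "\<dots> = ennreal (1/2) ^ card I * (\<Sum>n\<le>card I. of_nat (card I choose n) * (\<integral>\<^sup>+x. f x \<partial>half_gamma n))"
      by (rule nn_integral_sum_pos_part_square[OF I fm \<tau>])
    \<comment> \<open>The term \<open>n = 0\<close> is the point mass at 0, where \<open>f\<close>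
      vanishes.\<close>
    also have "(\<Sum>n\<le>card I. of_nat (card I choose n) * (\<integral>\<^sup>+x. f x \<partial>half_gamma n)) =
       (\<Sum>n=1..card I. of_nat (card I choose n) * (\<integral>\<^sup>+x. f x \<partial>half_gamma n))"
      by (rule sum.mono_neutral_right) (auto simp: half_gamma_def nn_integral_return f_def not_le)
    also have "\<dots> = (\<Sum>n=1..card I. of_nat (card I choose n) * (\<integral>\<^sup>+x. ennreal (gamma_density (real n / 2) x) * f x \<partial>lborel))"
      by (intro sum.cong refl) (auto simp: half_gamma_def nn_integral_density)
    also have "ennreal (1/2) ^ card I * \<dots> =
       (\<Sum>n=1..card I. \<integral>\<^sup>+x. ennreal (real (card I choose n) / 2 ^ card I) * (ennreal (gamma_density (real n / 2) x) * f x) \<partial>lborel)"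
      unfolding sum_distrib_left
    proof (intro sum.cong refl)
      fix n
      have "ennreal (1/2) ^ card I * of_nat (card I choose n) = ennreal (real (card I choose n) / 2 ^ card I)"
        by (subst ennreal_power) (auto simp: ennreal_of_nat_eq_real_of_nat ennreal_mult'[symmetric] power_one_over field_simps)
      then show "ennreal (1/2) ^ card I * (of_nat (card I choose n) * (\<integral>\<^sup>+x. ennreal (gamma_density (real n / 2) x) * f x \<partial>lborel)) =
        (\<integral>\<^sup>+x. ennreal (real (card I choose n) / 2 ^ card I) * (ennreal (gamma_density (real n / 2) x) * f x) \<partial>lborel)"
        by (subst nn_integral_cmult) (auto simp: mult.assoc[symmetric])
    qed
    also have "\<dots> = (\<integral>\<^sup>+x. (\<Sum>n=1..card I. ennreal (real (card I choose n) / 2 ^ card I) * (ennreal (gamma_density (real n / 2) x) * f x)) \<partial>lborel)"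
      by (subst nn_integral_sum) auto
    also have "\<dots> = (\<integral>\<^sup>+x. ennreal (h x) * f x \<partial>lborel)"
    proof (intro nn_integral_cong)
      fix x
      have "ennreal (h x) = (\<Sum>n=1..card I. ennreal (real (card I choose n) / 2 ^ card I) * ennreal (gamma_density (real n / 2) x))"
        unfolding h_def by (subst sum_ennreal[symmetric]) (auto simp: gamma_density_nonneg ennreal_mult[symmetric] intro!: mult_nonneg_nonneg sum.cong)
      then show "(\<Sum>n=1..card I. ennreal (real (card I choose n) / 2 ^ card I) * (ennreal (gamma_density (real n / 2) x) * f x)) = ennreal (h x) * f x"
        by (simp add: sum_distrib_right mult.assoc)
    qed
    \<comment> \<open>The point 0 may be put back into \<open>A\<close>, since
      \<open>h 0 = 0\<close>.\<close>
    also have "\<dots> = emeasure (density lborel (\<lambda>x. ennreal (h x))) A"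
      by (subst emeasure_density)
         (auto intro!: nn_integral_cong simp: f_def h_def gamma_density_def split: split_indicator)
    finally show "emeasure (density ?D (\<lambda>x. ennreal (indicator (-{0}) x))) A = emeasure (density lborel (\<lambda>x. ennreal (h x))) A" .
  qed simp
  have "(\<integral>\<omega>. logchar t (?S \<omega>) \<partial>?P) = (\<integral>x. logchar t x \<partial>?D)"
    by (subst integral_distr) auto
  also have "\<dots> = (\<integral>x. indicator (-{0}) x *\<^sub>R logchar t x \<partial>?D)"
    by (intro Bochner_Integration.integral_cong) (auto simp: logchar_def)
  also have "\<dots> = (\<integral>x. logchar t x \<partial>density ?D (\<lambda>x. ennreal (indicator (-{0}) x)))"
    by (subst integral_density) auto
  also have "\<dots> = (\<integral>x. h x *\<^sub>R logchar t x \<partial>lborel)"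
    unfolding eq using h0 by (subst integral_density) auto
  also have "\<dots> = (\<integral>x. (\<Sum>n=1..card I. (real (card I choose n) / 2 ^ card I) *\<^sub>R (gamma_density (real n / 2) x *\<^sub>R logchar t x)) \<partial>lborel)"
    by (simp add: h_def scaleR_sum_left)
  also have "\<dots> = (\<Sum>n=1..card I. (real (card I choose n) / 2 ^ card I) *\<^sub>R (\<integral>x. gamma_density (real n / 2) x *\<^sub>R logchar t x \<partial>lborel))"
    by (subst Bochner_Integration.integral_sum)
       (auto intro!: integrable_scaleR_right integral_gamma_density_logchar(1) simp del: scaleR_scaleR)
  also have "\<dots> = gamma_mix (card I) t"
    unfolding gamma_mix_def
    by (intro sum.cong refl, subst integral_gamma_density_logchar(2)) (auto simp: scaleR_conv_of_real)
  finally have *: "(\<integral>\<omega>. logchar t (?S \<omega>) \<partial>?P) = gamma_mix (card I) t" .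
  have "(\<integral>\<omega>. logchar t (\<Sum>i\<in>I. (max 0 (\<omega> i))\<^sup>2) \<partial>?P) = (\<integral>\<omega>. logchar t (2 * \<tau>\<^sup>2) * logchar t (?S \<omega>) \<partial>?P)"
  proof (intro Bochner_Integration.integral_cong refl)
    fix \<omega> :: "'a \<Rightarrow> real"
    have "(\<Sum>i\<in>I. (max 0 (\<omega> i))\<^sup>2) = 2 * \<tau>\<^sup>2 * ?S \<omega>"
      using \<tau> by (simp add: sum_divide_distrib[symmetric])
    moreover have "0 \<le> ?S \<omega>" by (intro sum_nonneg) simp
    ultimately show "logchar t (\<Sum>i\<in>I. (max 0 (\<omega> i))\<^sup>2) = logchar t (2 * \<tau>\<^sup>2) * logchar t (?S \<omega>)"
      by (metis logchar_mult mult_nonneg_nonneg zero_le_numeral zero_le_power2)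
  qed
  also have "\<dots> = logchar t (2 * \<tau>\<^sup>2) * gamma_mix (card I) t"
    by (subst Bochner_Integration.integral_mult_right_zero) (simp add: *)
  finally show ?thesis .
qed

subsection \<open>Layers of the network\<close>

lemma prelu_0: "prelu 0 z = max 0 z"
  by (simp add: prelu_def max_def)

lemma prelu_measurable [measurable]: "prelu a \<in> borel_measurable borel"
  unfolding prelu_def[abs_def] by measurable

lemma norm_vec_square: "(norm (x :: real^'d))\<^sup>2 = (\<Sum>i\<in>UNIV. (x $ i)\<^sup>2)"
  unfolding power2_norm_eq_inner inner_vec_def by (simp add: power2_eq_square)

text \<open>Only the first \<open>k\<close> weight matrices enter; this makes layer \<open>k\<close>
  independent of the matrix applied next.\<close>

lemma layer_cong:
  assumes "\<And>j i l. j < k \<Longrightarrow> \<omega> (j, i, l) = \<omega>' (j, i, l)"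
  shows "layer a x0 \<omega> k = layer a x0 \<omega>' k"
  using assms by (induction k) auto

text \<open>The index set \<open>A\<close> is left general so that measurability is available both
  on the full weight space and on the product over the first \<open>k\<close> matrices, where the
  next layer is conditioned.\<close>

lemma layer_nth_measurable:
  fixes x0 :: "real^'d"
  assumes "{..<k} \<times> UNIV \<subseteq> A" and N: "sets N = sets borel"
  shows "(\<lambda>\<omega>. layer a x0 \<omega> k $ i) \<in> borel_measurable (PiM A (\<lambda>_. N))"
  using assms(1)
proof (induction k arbitrary: i)
  case (Suc k)
  have "{..<k} \<times> UNIV \<subseteq> A" using Suc.prems by auto
  note [measurable] = Suc.IH[OF this]
  have [measurable]: "(\<lambda>\<omega>. \<omega> (k, i, j)) \<in> borel_measurable (PiM A (\<lambda>_. N))" for j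
    using measurable_component_singleton[of "(k, i, j)" A "\<lambda>_. N"] Suc.prems
    by (auto simp: measurable_cong_sets[OF refl N])
  show ?case by simp
qed simp

lemma layer_norm_measurable:
  fixes x0 :: "real^'d"
  assumes "{..<k} \<times> UNIV \<subseteq> A" and "sets N = sets borel"
  shows "(\<lambda>\<omega>. norm (layer a x0 \<omega> k)) \<in> borel_measurable (PiM A (\<lambda>_. N))"
proof -
  note [measurable] = layer_nth_measurable[OF assms]
  have "(\<lambda>\<omega>. norm (layer a x0 \<omega> k)) = (\<lambda>\<omega>. sqrt (\<Sum>i\<in>UNIV. (layer a x0 \<omega> k $ i)\<^sup>2))"
    by (metis norm_vec_square norm_ge_zero real_sqrt_abs abs_of_nonneg)
  then show ?thesis by simp
qed

section \<open>Gaussian weights and the recursion over layers\<close>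

context
  fixes \<sigma> :: real
  assumes \<sigma>: "\<sigma> > 0"
begin

private abbreviation (input) "N \<equiv> density lborel (normal_density 0 \<sigma>)"

private lemma prob_space_N: "prob_space N"
  by (rule prob_space_normal_density[OF \<sigma>])

lemma prob_space_weight_space: "prob_space (weight_space \<sigma>)"
  unfolding weight_space_def by (rule prob_space_PiM) (rule prob_space_N)

text \<open>Independence means that the joint law is the product of the marginals; here the joint
  law of the coordinates is the product measure itself.\<close>

lemma indep_vars_weights:
  "prob_space.indep_vars (weight_space \<sigma> :: (nat \<times> 'd::finite \<times> 'd \<Rightarrow> real) measure) (\<lambda>_. N) (\<lambda>i \<omega>. \<omega> i) UNIV"
proof -
  let ?M = "weight_space \<sigma> :: (nat \<times> 'd::finite \<times> 'd \<Rightarrow> real) measure"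
  interpret M: prob_space ?M by (rule prob_space_weight_space)
  have comp: "distr ?M N (\<lambda>\<omega>. \<omega> i) = N" for i
    unfolding weight_space_def by (rule distr_PiM_component) (auto intro: prob_space_N)
  have rv: "(\<lambda>\<omega>. \<omega> i) \<in> measurable ?M N" for i
    unfolding weight_space_def by (rule measurable_component_singleton) simp
  have "distr ?M (PiM UNIV (\<lambda>_. N)) (\<lambda>\<omega>. \<lambda>i\<in>UNIV. \<omega> i) = PiM UNIV (\<lambda>i. distr ?M N (\<lambda>\<omega>. \<omega> i))"
    unfolding comp by (simp add: weight_space_def restrict_def)
  then show ?thesis using rv by (subst M.indep_vars_iff_distr_eq_PiM) auto
qed

lemma distributed_weight:
  "distributed (weight_space \<sigma> :: (nat \<times> 'd::finite \<times> 'd \<Rightarrow> real) measure) lborel (\<lambda>\<omega>. \<omega> i) (normal_density 0 \<sigma>)"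
proof -
  let ?M = "weight_space \<sigma> :: (nat \<times> 'd::finite \<times> 'd \<Rightarrow> real) measure"
  have comp: "distr ?M N (\<lambda>\<omega>. \<omega> i) = N"
    unfolding weight_space_def by (rule distr_PiM_component) (auto intro: prob_space_N)
  have rv: "(\<lambda>\<omega>. \<omega> i) \<in> measurable ?M N"
    unfolding weight_space_def by (rule measurable_component_singleton) simp
  have "distr ?M lborel (\<lambda>\<omega>. \<omega> i) = distr ?M N (\<lambda>\<omega>. \<omega> i)" by (rule distr_cong) auto
  with comp rv show ?thesis by (simp add: distributed_def)
qed

text \<open>Independent centred normals add up with summed variances, here
  \<open>\<sigma>\<^sup>2\<close> times the squares of the coordinates of \<open>x\<close>.\<close>

lemma distributed_row:
  fixes x :: "real^'d"
  assumes x: "x \<noteq> 0"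
  shows "distributed (weight_space \<sigma>) lborel (\<lambda>\<omega>. \<Sum>j\<in>UNIV. \<omega> (k, i, j) * x $ j) (normal_density 0 (\<sigma> * norm x))"
proof -
  let ?M = "weight_space \<sigma> :: (nat \<times> 'd \<times> 'd \<Rightarrow> real) measure"
  interpret M: prob_space ?M by (rule prob_space_weight_space)
  \<comment> \<open>Zero coordinates are left out because their terms are constant and have no
    normal density; \<open>x \<noteq> 0\<close> keeps the index set nonempty.\<close>
  let ?J = "{j. x $ j \<noteq> 0}"
  have "M.indep_vars (\<lambda>j. PiM {(k,i,j)} (\<lambda>_. N)) (\<lambda>j \<omega>. restrict (\<lambda>p. \<omega> p) {(k,i,j)}) ?J"
    by (rule M.indep_vars_restrict[OF indep_vars_weights]) (auto simp: disjoint_family_on_def)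
  then have ind: "M.indep_vars (\<lambda>_. borel) (\<lambda>j \<omega>. (restrict (\<lambda>p. \<omega> p) {(k,i,j)}) (k,i,j) * x $ j) ?J"
  proof (rule M.indep_vars_compose2)
    fix j :: 'd
    have "(\<lambda>v. v (k, i, j)) \<in> borel_measurable (PiM {(k, i, j)} (\<lambda>_. N))"
      using measurable_component_singleton[of "(k, i, j)" "{(k, i, j)}" "\<lambda>_. N"] by simp
    then show "(\<lambda>v. v (k, i, j) * x $ j) \<in> borel_measurable (PiM {(k, i, j)} (\<lambda>_. N))" by measurable
  qed
  have "distributed ?M lborel (\<lambda>\<omega>. \<Sum>j\<in>?J. \<omega> (k, i, j) * x $ j)
      (normal_density (\<Sum>j\<in>?J. 0) (sqrt (\<Sum>j\<in>?J. (\<bar>x $ j\<bar> * \<sigma>)\<^sup>2)))"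
  proof (rule M.sum_indep_normal)
    show "?J \<noteq> {}" using x by (auto simp: vec_eq_iff)
    show "distributed ?M lborel (\<lambda>\<omega>. \<omega> (k, i, j) * x $ j) (normal_density 0 (\<bar>x $ j\<bar> * \<sigma>))" if "j \<in> ?J" for j
      using M.normal_density_affine[OF distributed_weight \<sigma>, of "x $ j" 0 "(k, i, j)"] that
      by (simp add: mult.commute)
  qed (use ind \<sigma> in auto)
  moreover have "sqrt (\<Sum>j\<in>?J. (\<bar>x $ j\<bar> * \<sigma>)\<^sup>2) = \<sigma> * norm x"
  proof -
    have "(\<Sum>j\<in>?J. (\<bar>x $ j\<bar> * \<sigma>)\<^sup>2) = (\<Sum>j\<in>UNIV. (\<bar>x $ j\<bar> * \<sigma>)\<^sup>2)"
      by (rule sum.mono_neutral_left) auto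
    also have "\<dots> = (\<sigma> * norm x)\<^sup>2"
      by (simp add: power_mult_distrib norm_vec_square sum_distrib_left mult.commute)
    finally show ?thesis using \<sigma> by simp
  qed
  moreover have "(\<Sum>j\<in>?J. \<omega> (k, i, j) * x $ j) = (\<Sum>j\<in>UNIV. \<omega> (k, i, j) * x $ j)" for \<omega> :: "nat \<times> 'd \<times> 'd \<Rightarrow> real"
    by (rule sum.mono_neutral_left) auto
  ultimately show ?thesis by simp
qed

text \<open>Different rows use disjoint blocks of weights, so for \<open>x \<noteq> 0\<close> the
  preactivations are independent normals with standard deviation \<open>\<sigma> * norm x\<close>,
  and the previous formula applies to their product law. For \<open>x = 0\<close> both sides are 0,
  so the recursion needs no separate treatment of networks that have died.\<close>

lemma expectation_logchar_row_layer:
  fixes x :: "real^'d"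
  shows "(\<integral>\<omega>. logchar t (\<Sum>i\<in>UNIV. (max 0 (\<Sum>j\<in>UNIV. \<omega> (k, i, j) * x $ j))\<^sup>2) \<partial>weight_space \<sigma>) =
    logchar t (2 * \<sigma>\<^sup>2) * gamma_mix CARD('d) t * logchar t ((norm x)\<^sup>2)"
proof (cases "x = 0")
  case True
  then show ?thesis by (simp add: logchar_def)
next
  case False
  let ?M = "weight_space \<sigma> :: (nat \<times> 'd \<times> 'd \<Rightarrow> real) measure"
  interpret M: prob_space ?M by (rule prob_space_weight_space)
  let ?U = "\<lambda>i \<omega>. \<Sum>j\<in>UNIV. \<omega> (k, i, j) * x $ j"
  let ?K = "\<lambda>i::'d. {k} \<times> {i} \<times> (UNIV :: 'd set)"
  have Um: "?U i \<in> borel_measurable ?M" for i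
    using distributed_row[OF False, of k i] by (simp add: distributed_def)
  have dU: "distr ?M borel (?U i) = density lborel (normal_density 0 (\<sigma> * norm x))" for i
  proof -
    have "distr ?M borel (?U i) = distr ?M lborel (?U i)" by (rule distr_cong) auto
    also have "\<dots> = density lborel (normal_density 0 (\<sigma> * norm x))"
      using distributed_row[OF False, of k i] by (simp add: distributed_def)
    finally show ?thesis .
  qed
  have "M.indep_vars (\<lambda>i. PiM (?K i) (\<lambda>_. N)) (\<lambda>i \<omega>. restrict (\<lambda>p. \<omega> p) (?K i)) UNIV"
    by (rule M.indep_vars_restrict[OF indep_vars_weights]) (auto simp: disjoint_family_on_def)
  then have "M.indep_vars (\<lambda>_. borel) (\<lambda>i \<omega>. \<Sum>j\<in>UNIV. (restrict (\<lambda>p. \<omega> p) (?K i)) (k,i,j) * x $ j) UNIV"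
  proof (rule M.indep_vars_compose2)
    fix i :: 'd
    have [measurable]: "(\<lambda>v. v (k, i, j)) \<in> borel_measurable (PiM (?K i) (\<lambda>_. N))" for j
      using measurable_component_singleton[of "(k, i, j)" "?K i" "\<lambda>_. N"] by simp
    show "(\<lambda>v. \<Sum>j\<in>UNIV. v (k, i, j) * x $ j) \<in> borel_measurable (PiM (?K i) (\<lambda>_. N))" by measurable
  qed
  then have "M.indep_vars (\<lambda>_. borel) ?U UNIV" by simp
  then have dist: "distr ?M (PiM UNIV (\<lambda>_. borel)) (\<lambda>\<omega>. \<lambda>i\<in>UNIV. ?U i \<omega>) =
      PiM UNIV (\<lambda>_. density lborel (normal_density 0 (\<sigma> * norm x)))"
    using Um by (subst (asm) M.indep_vars_iff_distr_eq_PiM) (auto simp: dU)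
  have "(\<integral>\<omega>. logchar t (\<Sum>i\<in>UNIV. (max 0 (?U i \<omega>))\<^sup>2) \<partial>?M) =
    (\<integral>v. logchar t (\<Sum>i\<in>UNIV. (max 0 (v i))\<^sup>2) \<partial>distr ?M (PiM UNIV (\<lambda>_. borel)) (\<lambda>\<omega>. \<lambda>i\<in>UNIV. ?U i \<omega>))"
    using Um by (subst integral_distr) (auto intro!: measurable_restrict)
  also have "\<dots> = logchar t (2 * (\<sigma> * norm x)\<^sup>2) * gamma_mix CARD('d) t"
    unfolding dist using \<sigma> False by (subst expectation_logchar_sum_pos_part_square) auto
  also have "\<dots> = logchar t (2 * \<sigma>\<^sup>2) * gamma_mix CARD('d) t * logchar t ((norm x)\<^sup>2)"
    using logchar_mult[of "2 * \<sigma>\<^sup>2" "(norm x)\<^sup>2" t] by (simp add: power_mult_distrib mult_ac)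
  finally show ?thesis .
qed

text \<open>Conditioning on the first \<open>k\<close> matrices freezes the input of the next layer.
  By independence and Fubini the inner expectation is the one-layer formula at that fixed
  input.\<close>

lemma expectation_logchar_layer_Suc:
  fixes x0 :: "real^'d"
  shows "(\<integral>\<omega>. logchar t ((norm (layer 0 x0 \<omega> (Suc k)))\<^sup>2) \<partial>weight_space \<sigma>) =
    logchar t (2 * \<sigma>\<^sup>2) * gamma_mix CARD('d) t * (\<integral>\<omega>. logchar t ((norm (layer 0 x0 \<omega> k))\<^sup>2) \<partial>weight_space \<sigma>)"
proof -
  let ?M = "weight_space \<sigma> :: (nat \<times> 'd \<times> 'd \<Rightarrow> real) measure"
  interpret M: prob_space ?M by (rule prob_space_weight_space)
  let ?A = "{..<k} \<times> (UNIV :: ('d \<times> 'd) set)" and ?B = "{k} \<times> (UNIV :: ('d \<times> 'd) set)"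
  let ?PA = "PiM ?A (\<lambda>_. N)" and ?PB = "PiM ?B (\<lambda>_. N)"
  let ?X = "\<lambda>\<omega>. restrict (\<lambda>p. \<omega> p) ?A" and ?Y = "\<lambda>\<omega>. restrict (\<lambda>p. \<omega> p) ?B"
  \<comment> \<open>The two roles of the weights are separated: \<open>u\<close> produces layer
    \<open>k\<close>, and \<open>w\<close> supplies the next matrix.\<close>
  define G where "G u w = logchar t (\<Sum>i\<in>UNIV. (max 0 (\<Sum>j\<in>UNIV. w (k, i, j) * layer 0 x0 u k $ j))\<^sup>2)"
    for u w :: "nat \<times> 'd \<times> 'd \<Rightarrow> real"
  have ind: "M.indep_var ?PA ?X ?PB ?Y"
    by (rule M.indep_var_restrict[OF indep_vars_weights]) auto
  have Xm [measurable]: "?X \<in> measurable ?M ?PA" and Ym [measurable]: "?Y \<in> measurable ?M ?PB"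
    and joint: "distr ?M ?PA ?X \<Otimes>\<^sub>M distr ?M ?PB ?Y = distr ?M (?PA \<Otimes>\<^sub>M ?PB) (\<lambda>\<omega>. (?X \<omega>, ?Y \<omega>))"
    using ind unfolding M.indep_var_distribution_eq by blast+
  interpret PX: prob_space "distr ?M ?PA ?X" by (rule M.prob_space_distr) (rule Xm)
  interpret PY: prob_space "distr ?M ?PB ?Y" by (rule M.prob_space_distr) (rule Ym)
  interpret P: pair_prob_space "distr ?M ?PA ?X" "distr ?M ?PB ?Y" ..
  have [measurable]: "(\<lambda>u. layer 0 x0 u k $ j) \<in> borel_measurable ?PA" for j
    by (rule layer_nth_measurable) auto
  have [measurable]: "(\<lambda>w. w (k, i, j)) \<in> borel_measurable ?PB" for i j
    using measurable_component_singleton[of "(k, i, j)" ?B "\<lambda>_. N"] by simp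
  have Gm [measurable]: "(\<lambda>(u, w). G u w) \<in> borel_measurable (?PA \<Otimes>\<^sub>M ?PB)"
    unfolding G_def by measurable
  have nm: "(\<lambda>u. norm (layer 0 x0 u k)) \<in> borel_measurable ?PA"
    by (rule layer_norm_measurable) auto
  have int: "integrable (distr ?M ?PA ?X \<Otimes>\<^sub>M distr ?M ?PB ?Y) (\<lambda>(u, w). G u w)"
    by (rule P.P.integrable_const_bound[where B = 1]) (auto simp: G_def norm_logchar)
  have lX: "layer 0 x0 (?X \<omega>) k = layer 0 x0 \<omega> k" for \<omega> by (rule layer_cong) auto
  have "(\<integral>\<omega>. logchar t ((norm (layer 0 x0 \<omega> (Suc k)))\<^sup>2) \<partial>?M) = (\<integral>\<omega>. G (?X \<omega>) (?Y \<omega>) \<partial>?M)"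
    by (simp add: G_def norm_vec_square prelu_0 lX)
  also have "\<dots> = (\<integral>p. (\<lambda>(u, w). G u w) p \<partial>distr ?M (?PA \<Otimes>\<^sub>M ?PB) (\<lambda>\<omega>. (?X \<omega>, ?Y \<omega>)))"
    by (subst integral_distr) auto
  also have "\<dots> = (\<integral>u. \<integral>w. G u w \<partial>distr ?M ?PB ?Y \<partial>distr ?M ?PA ?X)"
    unfolding joint[symmetric] using P.integral_fst'[OF int] by simp
  also have "\<dots> = (\<integral>u. logchar t (2 * \<sigma>\<^sup>2) * gamma_mix CARD('d) t * logchar t ((norm (layer 0 x0 u k))\<^sup>2) \<partial>distr ?M ?PA ?X)"
  proof (intro Bochner_Integration.integral_cong refl)
    fix u assume "u \<in> space (distr ?M ?PA ?X)"
    then have [measurable]: "G u \<in> borel_measurable ?PB"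
      using measurable_compose[OF measurable_Pair1' Gm, of u] by simp
    \<comment> \<open>With \<open>u\<close> fixed, the integral is moved back to the full weight
      space, where the one-layer formula is stated.\<close>
    have "(\<integral>w. G u w \<partial>distr ?M ?PB ?Y) = (\<integral>\<omega>. G u (?Y \<omega>) \<partial>?M)"
      by (subst integral_distr) auto
    also have "\<dots> = logchar t (2 * \<sigma>\<^sup>2) * gamma_mix CARD('d) t * logchar t ((norm (layer 0 x0 u k))\<^sup>2)"
      unfolding expectation_logchar_row_layer[of t k, symmetric] by (simp add: G_def)
    finally show "(\<integral>w. G u w \<partial>distr ?M ?PB ?Y) = logchar t (2 * \<sigma>\<^sup>2) * gamma_mix CARD('d) t * logchar t ((norm (layer 0 x0 u k))\<^sup>2)" .
  qed
  also have "\<dots> = (\<integral>\<omega>. logchar t (2 * \<sigma>\<^sup>2) * gamma_mix CARD('d) t * logchar t ((norm (layer 0 x0 (?X \<omega>) k))\<^sup>2) \<partial>?M)"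
    using nm by (subst integral_distr) auto
  also have "\<dots> = logchar t (2 * \<sigma>\<^sup>2) * gamma_mix CARD('d) t * (\<integral>\<omega>. logchar t ((norm (layer 0 x0 \<omega> k))\<^sup>2) \<partial>?M)"
    unfolding lX by simp
  finally show ?thesis .
qed

lemma expectation_logchar_layer:
  fixes x0 :: "real^'d"
  shows "(\<integral>\<omega>. logchar t ((norm (layer 0 x0 \<omega> k))\<^sup>2) \<partial>weight_space \<sigma>) =
    logchar t ((norm x0)\<^sup>2) * (logchar t (2 * \<sigma>\<^sup>2) * gamma_mix CARD('d) t) ^ k"
proof (induction k)
  case 0
  interpret M: prob_space "weight_space \<sigma> :: (nat \<times> 'd \<times> 'd \<Rightarrow> real) measure" by (rule prob_space_weight_space)
  show ?case by (simp add: M.prob_space)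
next
  case (Suc k)
  then show ?case by (simp only: expectation_logchar_layer_Suc power_Suc mult_ac)
qed

end

section \<open>Survival probability and the characteristic function of the conditioned law\<close>

lemma sum_choose_pos: "(\<Sum>n=1..d. real (d choose n)) = 2 ^ d - 1"
proof -
  have "(\<Sum>n\<le>d. d choose n) = (\<Sum>n=0..d. d choose n)" by (simp add: atMost_atLeast0)
  also have "\<dots> = 1 + (\<Sum>n=1..d. d choose n)" by (subst sum.atLeast_Suc_atMost) auto
  finally have "(\<Sum>n=1..d. d choose n) = 2 ^ d - 1" using choose_row_sum[of d] by simp
  then have "real (\<Sum>n=1..d. d choose n) = 2 ^ d - 1" by (simp add: of_nat_diff)
  then show ?thesis by simp
qed

text \<open>At \<open>t = 0\<close> every Gamma quotient is 1, leaving the probability that at least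
  one of \<open>d\<close> independent signs is positive: the chance that a nonzero input survives
  one layer.\<close>

lemma gamma_mix_0: "gamma_mix d 0 = of_real ((2 ^ d - 1) / 2 ^ d)"
proof -
  have G: "Gamma (real n / 2) > 0" if "n \<in> {1..d}" for n using that by (intro Gamma_real_pos) auto
  have "gamma_mix d 0 = (\<Sum>n=1..d. of_real (real (d choose n) / 2 ^ d))"
    unfolding gamma_mix_def
  proof (intro sum.cong refl)
    fix n assume n: "n \<in> {1..d}"
    have "Gamma (complex_of_real (real n / 2) + \<i> * of_real 0 / 2) = of_real (Gamma (real n / 2))"
      unfolding Gamma_complex_of_real[symmetric] by simp
    with G[OF n] show "complex_of_real (real (d choose n) / 2 ^ d) *
         (Gamma (complex_of_real (real n / 2) + \<i> * of_real 0 / 2) / of_real (Gamma (real n / 2))) =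
         of_real (real (d choose n) / 2 ^ d)" by simp
  qed
  also have "\<dots> = of_real ((\<Sum>n=1..d. real (d choose n)) / 2 ^ d)"
    by (simp only: of_real_sum sum_divide_distrib)
  finally show ?thesis by (simp only: sum_choose_pos)
qed

text \<open>The indicator of survival is \<open>logchar 0\<close> of the squared norm, so the
  normalizing constant and the numerator of the characteristic function are two cases of
  \<open>expectation_logchar_layer\<close>.\<close>

lemma R_law_facts:
  fixes x0 :: "real^'d"
  assumes \<sigma>: "\<sigma> > 0" and x0: "x0 \<noteq> 0"
  shows real_distribution_R_law: "real_distribution (R_law 0 \<sigma> x0 k)"
    and char_R_law: "char (R_law 0 \<sigma> x0 k) t = iexp (t * ln (norm x0)) *
      (logchar t (2 * \<sigma>\<^sup>2) * gamma_mix CARD('d) t / gamma_mix CARD('d) 0) ^ k"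
proof -
  let ?M = "weight_space \<sigma> :: (nat \<times> 'd \<times> 'd \<Rightarrow> real) measure"
  let ?g = "gamma_mix CARD('d) 0"
  interpret M: prob_space ?M by (rule prob_space_weight_space[OF \<sigma>])
  define E where "E = {\<omega> \<in> space ?M. layer 0 x0 \<omega> k \<noteq> 0}"
  define p where "p = measure ?M E"
  have nm [measurable]: "(\<lambda>\<omega>. norm (layer 0 x0 \<omega> k)) \<in> borel_measurable ?M"
    unfolding weight_space_def by (rule layer_norm_measurable) auto
  have "E = {\<omega> \<in> space ?M. norm (layer 0 x0 \<omega> k) \<noteq> 0}" by (simp add: E_def)
  also have "\<dots> \<in> sets ?M" by measurable
  finally have Em [measurable]: "E \<in> sets ?M" .
  have "complex_of_real p = (\<integral>\<omega>. of_real (indicator E \<omega>) \<partial>?M)"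
    by (simp add: p_def Int_absorb1 sets.sets_into_space[OF Em])
  also have "\<dots> = (\<integral>\<omega>. logchar 0 ((norm (layer 0 x0 \<omega> k))\<^sup>2) \<partial>?M)"
    by (intro Bochner_Integration.integral_cong) (auto simp: E_def logchar_def)
  also have "\<dots> = ?g ^ k"
    using x0 \<sigma> by (subst expectation_logchar_layer[OF \<sigma>]) (simp add: logchar_def)
  finally have pc: "complex_of_real p = ?g ^ k" .
  \<comment> \<open>Positivity of the survival probability makes the conditioned measure a genuine
    probability measure.\<close>
  have "(2::real) ^ CARD('d) > 1" by (rule one_less_power) auto
  then have q: "(2 ^ CARD('d) - 1) / 2 ^ CARD('d) > (0::real)" by simp
  have "complex_of_real p = of_real (((2 ^ CARD('d) - 1) / 2 ^ CARD('d)) ^ k)"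
    unfolding pc by (simp add: gamma_mix_0)
  then have "p = ((2 ^ CARD('d) - 1) / 2 ^ CARD('d)) ^ k" unfolding of_real_eq_iff .
  then have p: "p > 0" using q by simp
  let ?D = "density ?M (\<lambda>\<omega>. ennreal (indicator E \<omega> / p))"
  have R: "R_law 0 \<sigma> x0 k = distr ?D borel (\<lambda>\<omega>. ln (norm (layer 0 x0 \<omega> k)))"
    by (simp add: R_law_def E_def p_def Let_def)
  have "prob_space ?D"
  proof (rule prob_spaceI)
    have "emeasure ?D (space ?D) = (\<integral>\<^sup>+\<omega>. ennreal (1 / p) * indicator E \<omega> \<partial>?M)"
      by (subst emeasure_density) (auto intro!: nn_integral_cong split: split_indicator)
    also have "\<dots> = ennreal (1 / p) * ennreal p"
      by (subst nn_integral_cmult_indicator) (auto simp: p_def M.emeasure_eq_measure)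
    also have "\<dots> = 1" using p by (simp add: ennreal_mult'[symmetric])
    finally show "emeasure ?D (space ?D) = 1" .
  qed
  then interpret D: prob_space ?D .
  show "real_distribution (R_law 0 \<sigma> x0 k)"
    unfolding R by (rule D.real_distribution_distr) measurable
  have "char (R_law 0 \<sigma> x0 k) t = (\<integral>\<omega>. iexp (t * ln (norm (layer 0 x0 \<omega> k))) \<partial>?D)"
    unfolding R char_def by (subst integral_distr) auto
  also have "\<dots> = (\<integral>\<omega>. (indicator E \<omega> / p) *\<^sub>R iexp (t * ln (norm (layer 0 x0 \<omega> k))) \<partial>?M)"
    using p by (subst integral_density) auto
  \<comment> \<open>The indicator of \<open>E\<close> is absorbed by the value of
    \<open>logchar t\<close> at 0; on \<open>E\<close> the factor \<open>t / 2\<close> cancels the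
    square of the norm under the logarithm.\<close>
  also have "\<dots> = (\<integral>\<omega>. of_real (1 / p) * logchar t ((norm (layer 0 x0 \<omega> k))\<^sup>2) \<partial>?M)"
    by (intro Bochner_Integration.integral_cong refl)
       (auto simp: E_def logchar_def ln_realpow scaleR_conv_of_real split: split_indicator)
  also have "\<dots> = of_real (1 / p) * (logchar t ((norm x0)\<^sup>2) * (logchar t (2 * \<sigma>\<^sup>2) * gamma_mix CARD('d) t) ^ k)"
    by (subst Bochner_Integration.integral_mult_right_zero, subst expectation_logchar_layer[OF \<sigma>]) simp
  also have "\<dots> = iexp (t * ln (norm x0)) * (logchar t (2 * \<sigma>\<^sup>2) * gamma_mix CARD('d) t / ?g) ^ k"
    using x0 by (simp add: pc logchar_def ln_realpow power_divide)
  finally show "char (R_law 0 \<sigma> x0 k) t = iexp (t * ln (norm x0)) *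
      (logchar t (2 * \<sigma>\<^sup>2) * gamma_mix CARD('d) t / ?g) ^ k" .
qed

subsection \<open>Limits of laws and of characteristic functions\<close>

text \<open>Tightness: for a fixed level \<open>m\<close>, eventually below \<open>c n\<close>, the
  tail is bounded by the two-sided tail at \<open>m\<close>. That tail converges to the one of
  \<open>L\<close>, which is small for large \<open>m\<close>. Since \<open>L\<close> has no atoms,
  its distribution function is continuous everywhere and no level has to be avoided.\<close>

lemma tendsto_measure_abs_gt_0:
  fixes c :: "nat \<Rightarrow> real"
  assumes M: "\<And>n. real_distribution (M n)" and L: "real_distribution L"
    and conv: "weak_conv_m M L" and atoms: "\<And>x. measure L {x} = 0"
    and c: "filterlim c at_top sequentially"
  shows "(\<lambda>n. measure (M n) {y. \<bar>y\<bar> > c n}) \<longlonglongrightarrow> 0"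
proof -
  interpret M: real_distribution "M n" for n by (rule M)
  interpret L: real_distribution L by (rule L)
  have cdf: "(\<lambda>n. cdf (M n) x) \<longlonglongrightarrow> cdf L x" for x
    using conv L.isCont_cdf[of x] atoms[of x] by (auto simp: weak_conv_m_def weak_conv_def)
  have tail: "measure (M n) {y. \<bar>y\<bar> > c n} \<le> cdf (M n) (- m) + (1 - cdf (M n) m)" if "m \<le> c n" for n m
  proof -
    have "measure (M n) {y. \<bar>y\<bar> > c n} \<le> measure (M n) ({..- m} \<union> (space (M n) - {..m}))"
      by (rule M.finite_measure_mono) (use that in auto)
    also have "\<dots> \<le> measure (M n) {..- m} + measure (M n) (space (M n) - {..m})"
      by (rule measure_Un_le) auto
    also have "\<dots> = cdf (M n) (- m) + (1 - cdf (M n) m)"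
      by (subst M.prob_compl) (auto simp: cdf_def2)
    finally show ?thesis .
  qed
  show ?thesis
  proof (rule LIMSEQ_I)
    fix e :: real assume e: "e > 0"
    have "(\<lambda>m. cdf L (- real m) + (1 - cdf L (real m))) \<longlonglongrightarrow> 0 + (1 - 1)"
      by (intro tendsto_intros L.cdf_lim_neg_infty L.cdf_lim_infty_prob)
    then have "\<forall>\<^sub>F m in sequentially. cdf L (- real m) + (1 - cdf L (real m)) < e"
      using e by (intro order_tendstoD(2)[where y = 0]) auto
    then obtain m where m: "cdf L (- real m) + (1 - cdf L (real m)) < e"
      by (auto simp: eventually_sequentially)
    have "(\<lambda>n. cdf (M n) (- real m) + (1 - cdf (M n) (real m))) \<longlonglongrightarrow> cdf L (- real m) + (1 - cdf L (real m))"
      by (intro tendsto_intros cdf)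
    then have "\<forall>\<^sub>F n in sequentially. cdf (M n) (- real m) + (1 - cdf (M n) (real m)) < e"
      using m by (rule order_tendstoD)
    moreover have "\<forall>\<^sub>F n in sequentially. real m \<le> c n"
      using c by (auto simp: filterlim_at_top)
    ultimately have "\<forall>\<^sub>F n in sequentially. norm (measure (M n) {y. \<bar>y\<bar> > c n} - 0) < e"
      by eventually_elim (use tail in \<open>fastforce intro: le_less_trans\<close>)
    then show "\<exists>no. \<forall>n\<ge>no. norm (measure (M n) {y. \<bar>y\<bar> > c n} - 0) < e"
      by (simp add: eventually_sequentially)
  qed
qed

text \<open>The first two facts come from writing the law as the image of the standard normal law
  under multiplication by \<open>s\<close>.\<close>

lemma normal_distribution_facts:
  assumes s: "s > 0"
  shows real_distribution_normal: "real_distribution (density lborel (normal_density 0 s))"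
    and char_normal: "char (density lborel (normal_density 0 s)) t = exp (- (complex_of_real ((s * t)\<^sup>2 / 2)))"
    and measure_normal_singleton: "measure (density lborel (normal_density 0 s)) {x} = 0"
proof -
  let ?N = "density lborel (normal_density 0 s)"
  interpret S: real_distribution std_normal_distribution by (rule real_dist_normal_dist)
  have "distributed std_normal_distribution lborel (\<lambda>x. x) std_normal_density"
    by (auto simp: distributed_def intro!: distr_id2)
  from S.normal_density_affine[OF this, of s 0]
  have d: "distributed std_normal_distribution lborel (\<lambda>x. s * x) (normal_density 0 s)" using s by simp
  have "distr std_normal_distribution borel (\<lambda>x. s * x) = distr std_normal_distribution lborel (\<lambda>x. s * x)"
    by (rule distr_cong) auto
  also have "\<dots> = ?N" using d by (simp add: distributed_def)
  finally have eq: "?N = distr std_normal_distribution borel (\<lambda>x. s * x)" ..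
  show "real_distribution ?N" unfolding eq by (rule S.real_distribution_distr) simp
  have "char ?N t = char std_normal_distribution (s * t)"
    unfolding eq char_def by (subst integral_distr) (auto simp: mult_ac)
  then show "char ?N t = exp (- (complex_of_real ((s * t)\<^sup>2 / 2)))"
    by (simp add: char_std_normal_distribution exp_of_real[symmetric])
  have "emeasure ?N {x} = 0"
    by (subst emeasure_density) (auto simp: nn_integral_indicator_singleton)
  then show "measure ?N {x} = 0" by (simp add: measure_def)
qed

text \<open>The power is compared with \<open>(1 + w / k) ^ k\<close>, which tends to
  \<open>exp w\<close>. When both bases have norm at most 1, the \<open>k\<close>-th powers differ
  by at most \<open>k\<close> times the difference of the bases, so no complex logarithm is
  involved.\<close>

lemma tendsto_power_char_limit:
  fixes \<psi> :: "real \<Rightarrow> complex"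
  assumes le1: "\<And>u. norm (\<psi> u) \<le> 1" and \<psi>0: "\<psi> 0 = 1"
    and lim: "((\<lambda>u. (\<psi> u - 1) / of_real (u\<^sup>2)) \<longlongrightarrow> of_real (- v / 2)) (at 0)"
    and v: "v \<ge> 0"
  shows "(\<lambda>k. \<psi> (t / sqrt (real k)) ^ k) \<longlonglongrightarrow> exp (- of_real (v * t\<^sup>2 / 2))"
proof (cases "t = 0")
  case True
  then show ?thesis by (simp add: \<psi>0)
next
  case False
  define w where "w = - (v * t\<^sup>2 / 2)"
  have w: "w \<le> 0" using v by (simp add: w_def)
  have "(\<lambda>k. t / sqrt (real k)) \<longlonglongrightarrow> 0"
    by (intro tendsto_divide_0[OF tendsto_const] filterlim_at_top_imp_at_infinity
        filterlim_compose[OF sqrt_at_top filterlim_real_sequentially])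
  then have u0: "filterlim (\<lambda>k. t / sqrt (real k)) (at 0) sequentially"
    unfolding filterlim_at using False eventually_gt_at_top[of "0::nat"] by (auto elim: eventually_mono)
  have "(\<lambda>k. of_real (t\<^sup>2) * ((\<psi> (t / sqrt (real k)) - 1) / of_real ((t / sqrt (real k))\<^sup>2))) \<longlonglongrightarrow> of_real (t\<^sup>2) * of_real (- v / 2)"
    by (intro tendsto_mult tendsto_const filterlim_compose[OF lim u0])
  also have "complex_of_real (t\<^sup>2) * of_real (- v / 2) = of_real w" by (simp add: w_def)
  finally have "(\<lambda>k. of_nat k * (\<psi> (t / sqrt (real k)) - 1)) \<longlonglongrightarrow> of_real w"
    by (rule Lim_transform_eventually)
       (use eventually_gt_at_top[of "0::nat"] False in \<open>auto elim!: eventually_mono simp: power_divide field_simps\<close>)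
  then have "(\<lambda>k. norm (of_nat k * (\<psi> (t / sqrt (real k)) - 1) - of_real w)) \<longlonglongrightarrow> 0"
    by (simp add: tendsto_norm_zero_iff LIM_zero_iff)
  moreover have "\<forall>\<^sub>F k in sequentially. norm (\<psi> (t / sqrt (real k)) ^ k - of_real ((1 + w / real k) ^ k)) \<le>
      norm (of_nat k * (\<psi> (t / sqrt (real k)) - 1) - of_real w)"
    \<comment> \<open>From this index on \<open>- w \<le> k\<close>, so \<open>1 + w / k\<close>
      lies between 0 and 1.\<close>
    using eventually_ge_at_top[of "nat \<lceil>- w\<rceil>"] eventually_gt_at_top[of "0::nat"]
  proof eventually_elim
    case (elim k)
    then have k: "- w \<le> real k" "k > 0" by linarith+
    then have "\<bar>1 + w / real k\<bar> \<le> 1" using w by (auto simp: abs_le_iff field_simps)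
    then have "norm (complex_of_real (1 + w / real k)) \<le> 1" unfolding norm_of_real .
    then have "norm (\<psi> (t / sqrt (real k)) ^ k - of_real (1 + w / real k) ^ k) \<le>
        real k * norm (\<psi> (t / sqrt (real k)) - of_real (1 + w / real k))"
      by (intro norm_power_diff le1)
    also have "\<dots> = norm (of_nat k * (\<psi> (t / sqrt (real k)) - of_real (1 + w / real k)))"
      by (simp add: norm_mult)
    also have "of_nat k * (\<psi> (t / sqrt (real k)) - of_real (1 + w / real k)) =
        of_nat k * (\<psi> (t / sqrt (real k)) - 1) - of_real w"
      using k by (simp add: field_simps)
    finally show ?case by simp
  qed
  ultimately have "(\<lambda>k. \<psi> (t / sqrt (real k)) ^ k - of_real ((1 + w / real k) ^ k)) \<longlonglongrightarrow> 0"
    by (rule Lim_null_comparison[rotated])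
  moreover have "(\<lambda>k. complex_of_real ((1 + w / real k) ^ k)) \<longlonglongrightarrow> of_real (exp w)"
    by (intro tendsto_of_real tendsto_exp_limit_sequentially)
  ultimately have "(\<lambda>k. \<psi> (t / sqrt (real k)) ^ k) \<longlonglongrightarrow> of_real (exp w)"
    by (rule Lim_transform[rotated])
  then show ?thesis by (simp add: w_def exp_of_real[symmetric])
qed

text \<open>Subtracting the expected quadratic term leaves a function whose second derivative is
  \<open>f'' z - f'' 0\<close>, arbitrarily small near 0 by continuity. Taylor's remainder bound
  then gives an error of at most \<open>e / 2\<close> times the square of \<open>norm z\<close>; the
  linear term is absent because \<open>f' 0 = 0\<close>.\<close>

lemma second_order_limit:
  fixes f f' f'' :: "complex \<Rightarrow> complex"
  assumes r: "r > 0"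
    and d1: "\<And>z. z \<in> ball 0 r \<Longrightarrow> (f has_field_derivative f' z) (at z)"
    and d2: "\<And>z. z \<in> ball 0 r \<Longrightarrow> (f' has_field_derivative f'' z) (at z)"
    and cont: "isCont f'' 0" and f'0: "f' 0 = 0"
  shows "((\<lambda>z. (f z - f 0) / z\<^sup>2) \<longlongrightarrow> f'' 0 / 2) (at 0)"
proof (rule LIM_I)
  fix e :: real assume e: "e > 0"
  obtain \<delta> where \<delta>: "\<delta> > 0" "\<And>z. norm z < \<delta> \<Longrightarrow> norm (f'' z - f'' 0) < e / 2"
    using cont e unfolding continuous_at_eps_delta dist_norm by (metis diff_zero half_gt_zero)
  define \<rho> where "\<rho> = min \<delta> r"
  have \<rho>: "\<rho> > 0" using \<delta> r by (simp add: \<rho>_def)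
  \<comment> \<open>The function with its quadratic term removed, followed by its first two
    derivatives, indexed as the Taylor bound expects.\<close>
  define F where "F i = (if i = 0 then (\<lambda>z. f z - f'' 0 * z\<^sup>2 / 2) else if i = 1 then (\<lambda>z. f' z - f'' 0 * z)
     else (\<lambda>z. f'' z - f'' 0))" for i :: nat
  have "norm ((f z - f 0) / z\<^sup>2 - f'' 0 / 2) < e" if z: "z \<noteq> 0" "norm z < \<rho>" for z
  proof -
    have "norm (F 0 z - (\<Sum>i\<le>1. F i 0 * (z - 0) ^ i / fact i)) \<le> e / 2 * norm (z - 0) ^ Suc 1 / fact 1"
    proof (rule field_Taylor)
      show "convex (ball (0::complex) \<rho>)" by simp
      show "(F i has_field_derivative F (Suc i) x) (at x within ball 0 \<rho>)" if "x \<in> ball 0 \<rho>" "i \<le> 1" for i x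
      proof -
        have x: "x \<in> ball 0 r" using that by (simp add: \<rho>_def)
        from that(2) consider "i = 0" | "i = 1" by linarith
        then show ?thesis
        proof cases
          case 1
          have "((\<lambda>z. f z - f'' 0 * z\<^sup>2 / 2) has_field_derivative f' x - f'' 0 * (2 * x) / 2) (at x)"
            by (rule derivative_eq_intros d1[OF x] refl | simp)+
          with 1 show ?thesis by (simp add: F_def has_field_derivative_at_within)
        next
          case 2
          have "((\<lambda>z. f' z - f'' 0 * z) has_field_derivative f'' x - f'' 0) (at x)"
            by (rule derivative_eq_intros d2[OF x] refl | simp)+
          with 2 show ?thesis by (simp add: F_def has_field_derivative_at_within)
        qed
      qed
      show "norm (F (Suc 1) x) \<le> e / 2" if "x \<in> ball 0 \<rho>" for x
        using \<delta>(2)[of x] that by (simp add: F_def \<rho>_def)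
    qed (use z \<rho> in auto)
    then have "norm (f z - f 0 - f'' 0 * z\<^sup>2 / 2) \<le> e / 2 * norm z ^ 2"
      by (simp add: F_def f'0 algebra_simps power2_eq_square)
    then have "norm (f z - f 0 - f'' 0 * z\<^sup>2 / 2) / norm (z\<^sup>2) \<le> e / 2"
      using z by (simp add: norm_power divide_le_eq)
    moreover have "(f z - f 0) / z\<^sup>2 - f'' 0 / 2 = (f z - f 0 - f'' 0 * z\<^sup>2 / 2) / z\<^sup>2"
      using z by (simp add: field_simps)
    ultimately have "norm ((f z - f 0) / z\<^sup>2 - f'' 0 / 2) \<le> e / 2" by (simp only: norm_divide)
    with e show ?thesis by simp
  qed
  then show "\<exists>s>0. \<forall>z. z \<noteq> 0 \<and> norm (z - 0) < s \<longrightarrow> norm ((f z - f 0) / z\<^sup>2 - f'' 0 / 2) < e"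
    using \<rho> by auto
qed

subsection \<open>Second-order expansion of the mixture\<close>

lemma sum_pi_d:
  assumes "d > 0"
  shows "(\<Sum>n=1..d. pi_d d n) = 1"
proof -
  have "(2::real) ^ d > 1" using assms by (intro one_less_power) auto
  then show ?thesis
    unfolding pi_d_def sum_divide_distrib[symmetric] sum_choose_pos by simp
qed

text \<open>The number \<open>ln 2 + Digamma (n / 2)\<close> is the mean logarithm of a chi-square
  variable with \<open>n\<close> degrees of freedom, averaged here over the binomial number of
  degrees conditioned to be positive.\<close>

definition log_mean :: "nat \<Rightarrow> real" where
  "log_mean d = (\<Sum>n=1..d. pi_d d n * (ln 2 + Digamma (real n / 2)))"

lemma mu0_log_mean: "mu0 d \<sigma> = ln \<sigma> + log_mean d / 2"
  by (simp add: mu0_def log_mean_def)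

text \<open>The variance written around its mean, using that the weights sum to 1. This form matches
  the second derivative of \<open>centered_mix\<close> at 0 and makes positivity visible.\<close>

lemma s0sq_centered:
  assumes "d > 0"
  shows "4 * s0sq d = (\<Sum>n=1..d. pi_d d n *
    ((ln 2 - log_mean d + Digamma (real n / 2))\<^sup>2 + Polygamma 1 (real n / 2)))"
proof -
  let ?v = "\<lambda>n. ln 2 + Digamma (real n / 2)" and ?m = "log_mean d"
  have "(\<Sum>n=1..d. pi_d d n * ((ln 2 - ?m + Digamma (real n / 2))\<^sup>2 + Polygamma 1 (real n / 2))) =
    (\<Sum>n=1..d. pi_d d n * (Polygamma 1 (real n / 2) + (?v n)\<^sup>2) - 2 * ?m * (pi_d d n * ?v n) + ?m\<^sup>2 * pi_d d n)"
    by (intro sum.cong refl) (simp add: power2_eq_square algebra_simps)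
  also have "\<dots> = (\<Sum>n=1..d. pi_d d n * (Polygamma 1 (real n / 2) + (?v n)\<^sup>2)) - 2 * ?m * (\<Sum>n=1..d. pi_d d n * ?v n) + ?m\<^sup>2 * (\<Sum>n=1..d. pi_d d n)"
    by (simp only: sum.distrib sum_subtractf sum_distrib_left)
  also have "\<dots> = (\<Sum>n=1..d. pi_d d n * (Polygamma 1 (real n / 2) + (?v n)\<^sup>2)) - ?m\<^sup>2"
    unfolding sum_pi_d[OF assms] log_mean_def[symmetric] by (simp add: power2_eq_square)
  also have "\<dots> = 4 * s0sq d" by (simp add: s0sq_def log_mean_def)
  finally show ?thesis ..
qed

text \<open>In the centred form the squares are nonnegative, and the trigamma values and the weights
  are positive. Positivity ensures that the limit law is a nondegenerate normal law with a
  density.\<close>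

lemma s0sq_pos:
  assumes "d > 0"
  shows "s0sq d > 0"
proof -
  have "(2::real) ^ d > 1" using assms by (intro one_less_power) auto
  then have "(\<Sum>n=1..d. pi_d d n *
    ((ln 2 - log_mean d + Digamma (real n / 2))\<^sup>2 + Polygamma 1 (real n / 2))) > 0"
    using assms
    by (intro sum_pos mult_pos_pos add_nonneg_pos Polygamma_real_odd_pos)
       (auto simp: pi_d_def nonpos_Ints_def)
  then show ?thesis using s0sq_centered[OF assms] by simp
qed

text \<open>At \<open>z = i u / 2\<close> this is the characteristic function at \<open>u\<close> of one centred increment of
  \<open>ln \<parallel>x\<parallel>\<close>, conditioned on survival; here \<open>\<sigma>\<close> cancels.\<close>
definition centered_mix :: "nat \<Rightarrow> complex \<Rightarrow> complex" where
  "centered_mix d z = (\<Sum>n=1..d. of_real (pi_d d n) *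
     (exp (z * of_real (ln 2 - log_mean d)) * Gamma (of_real (real n / 2) + z) / of_real (Gamma (real n / 2))))"

text \<open>The \<open>ln \<sigma>\<close> in \<open>mu0\<close> cancels the one coming from
  \<open>2 * \<sigma>\<^sup>2\<close>, leaving \<open>ln 2 - log_mean d\<close>; division by
  \<open>gamma_mix d 0\<close> turns the binomial weights into \<open>pi_d\<close>.\<close>

lemma centered_mix_conv_gamma_mix:
  assumes d: "d > 0" and \<sigma>: "\<sigma> > 0"
  shows "iexp (- (mu0 d \<sigma> * u)) * (logchar u (2 * \<sigma>\<^sup>2) * gamma_mix d u / gamma_mix d 0) = centered_mix d (\<i> * of_real u / 2)"
proof -
  have p2: "(2::real) ^ d > 1" using d by (intro one_less_power) auto
  have "- (mu0 d \<sigma> * u) + u / 2 * ln (2 * \<sigma>\<^sup>2) = u / 2 * (ln 2 - log_mean d)"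
    using \<sigma> by (simp add: mu0_log_mean ln_mult ln_realpow algebra_simps)
  moreover have "iexp (- (mu0 d \<sigma> * u)) * logchar u (2 * \<sigma>\<^sup>2) = iexp (- (mu0 d \<sigma> * u) + u / 2 * ln (2 * \<sigma>\<^sup>2))"
    using \<sigma> unfolding logchar_def of_real_add distrib_left exp_add by simp
  ultimately have "iexp (- (mu0 d \<sigma> * u)) * logchar u (2 * \<sigma>\<^sup>2) = iexp (u / 2 * (ln 2 - log_mean d))"
    by (simp only:)
  then have e: "iexp (- (mu0 d \<sigma> * u)) * logchar u (2 * \<sigma>\<^sup>2) = exp (\<i> * of_real u / 2 * of_real (ln 2 - log_mean d))"
    by (simp add: mult.assoc)
  have g: "gamma_mix d u / gamma_mix d 0 = (\<Sum>n=1..d. of_real (pi_d d n) *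
     (Gamma (of_real (real n / 2) + \<i> * of_real u / 2) / of_real (Gamma (real n / 2))))"
  proof -
    have "of_real (real (d choose n) / 2 ^ d) / complex_of_real ((2 ^ d - 1) / 2 ^ d) = of_real (pi_d d n)" for n
      using p2 unfolding of_real_divide[symmetric] pi_d_def by (simp add: field_simps)
    then show ?thesis
      unfolding gamma_mix_0 unfolding gamma_mix_def sum_divide_distrib
      by (intro sum.cong refl) (metis times_divide_eq_left)
  qed
  have "iexp (- (mu0 d \<sigma> * u)) * (logchar u (2 * \<sigma>\<^sup>2) * gamma_mix d u / gamma_mix d 0) =
    iexp (- (mu0 d \<sigma> * u)) * logchar u (2 * \<sigma>\<^sup>2) * (gamma_mix d u / gamma_mix d 0)" by simp
  also have "\<dots> = centered_mix d (\<i> * of_real u / 2)"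
    unfolding e g centered_mix_def sum_distrib_left by (intro sum.cong refl) (simp add: mult_ac)
  finally show ?thesis .
qed

text \<open>Each summand \<open>T n\<close> has logarithmic derivative \<open>D n\<close>, and the
  derivative of \<open>D n\<close> is a trigamma function. Hence the first derivative of the mixture
  at 0 is the centred mean, which is 0, and the second is the centred variance sum
  \<open>4 * s0sq d\<close>, halved in the limit.\<close>

lemma centered_mix_second_order:
  assumes d: "d > 0"
  shows "centered_mix d 0 = 1"
    and "((\<lambda>z. (centered_mix d z - 1) / z\<^sup>2) \<longlongrightarrow> of_real (2 * s0sq d)) (at 0)"
proof -
  define b where "b = ln 2 - log_mean d"
  define T where "T n z = exp (z * of_real b) * Gamma (of_real (real n / 2) + z) / of_real (Gamma (real n / 2))"
    for n :: nat and z :: complex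
  define D where "D n z = of_real b + Digamma (of_real (real n / 2) + z)" for n :: nat and z :: complex
  have G: "Gamma (real n / 2) > 0" if "n \<in> {1..d}" for n using that by (intro Gamma_real_pos) auto
  \<comment> \<open>The radius 1/2 is chosen because \<open>n \<ge> 1\<close>: on that disc the
    argument has positive real part and avoids the poles of Gamma.\<close>
  have nz: "of_real (real n / 2) + z \<notin> \<int>\<^sub>\<le>\<^sub>0" if "n \<in> {1..d}" "z \<in> ball 0 (1/2)" for n and z :: complex
  proof
    assume "of_real (real n / 2) + z \<in> \<int>\<^sub>\<le>\<^sub>0"
    then obtain m where "of_real (real n / 2) + z = of_int m" "m \<le> 0" by (elim nonpos_Ints_cases)
    then have "Re (of_real (real n / 2) + z) \<le> 0" by (simp only: complex_Re_of_int of_int_le_0_iff)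
    moreover have "\<bar>Re z\<bar> < 1/2" using abs_Re_le_cmod[of z] that(2) by simp
    ultimately show False using that(1) by simp
  qed
  have T0: "T n 0 = 1" if "n \<in> {1..d}" for n
    using G[OF that] by (simp add: T_def Gamma_complex_of_real[symmetric] del: of_real_divide)
       (metis Gamma_complex_of_real of_real_divide of_real_of_nat_eq of_real_numeral of_real_eq_0_iff divide_self less_irrefl)
  have DT: "(T n has_field_derivative T n z * D n z) (at z)" if "n \<in> {1..d}" "z \<in> ball 0 (1/2)" for n z
    unfolding T_def D_def using nz[OF that] G[OF that(1)]
    by (auto intro!: derivative_eq_intros simp: field_simps)
  have DD: "(D n has_field_derivative Polygamma 1 (of_real (real n / 2) + z)) (at z)"
    if "n \<in> {1..d}" "z \<in> ball 0 (1/2)" for n z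
    unfolding D_def using nz[OF that] by (auto intro!: derivative_eq_intros)
  have D0: "D n 0 = of_real (b + Digamma (real n / 2))" if "n \<in> {1..d}" for n
    using that Polygamma_of_real[of "real n / 2" 0, where ?'a = complex] by (simp add: D_def)
  have P0: "Polygamma 1 (of_real (real n / 2) + 0) = complex_of_real (Polygamma 1 (real n / 2))" if "n \<in> {1..d}" for n
    using that Polygamma_of_real[of "real n / 2" 1, where ?'a = complex] by simp
  define f' where "f' z = (\<Sum>n=1..d. of_real (pi_d d n) * (T n z * D n z))" for z
  define f'' where "f'' z = (\<Sum>n=1..d. of_real (pi_d d n) * (T n z * ((D n z)\<^sup>2 + Polygamma 1 (of_real (real n / 2) + z))))" for z
  have f: "centered_mix d = (\<lambda>z. \<Sum>n=1..d. of_real (pi_d d n) * T n z)"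
    by (simp add: centered_mix_def T_def b_def fun_eq_iff)
  have "centered_mix d 0 = of_real (\<Sum>n=1..d. pi_d d n)"
    unfolding f of_real_sum by (intro sum.cong refl) (simp add: T0)
  then show one: "centered_mix d 0 = 1" unfolding sum_pi_d[OF d] by simp
  have "((\<lambda>z. (centered_mix d z - centered_mix d 0) / z\<^sup>2) \<longlongrightarrow> f'' 0 / 2) (at 0)"
  proof (rule second_order_limit[where r = "1/2" and f' = f'])
    show "(centered_mix d has_field_derivative f' z) (at z)" if "z \<in> ball 0 (1/2)" for z
      unfolding f f'_def by (intro DERIV_sum DERIV_cmult DT that)
    show "(f' has_field_derivative f'' z) (at z)" if "z \<in> ball 0 (1/2)" for z
      unfolding f'_def f''_def
    proof (intro DERIV_sum DERIV_cmult)
      fix n assume n: "n \<in> {1..d}"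
      show "((\<lambda>z. T n z * D n z) has_field_derivative T n z * ((D n z)\<^sup>2 + Polygamma 1 (of_real (real n / 2) + z))) (at z)"
        by (rule derivative_eq_intros DT[OF n that] DD[OF n that] refl)+ (simp add: power2_eq_square algebra_simps)
    qed
    have "f' 0 = of_real (\<Sum>n=1..d. pi_d d n * (b + Digamma (real n / 2)))"
      unfolding f'_def of_real_sum by (intro sum.cong refl) (simp add: T0 D0)
    also have "(\<Sum>n=1..d. pi_d d n * (b + Digamma (real n / 2))) =
       (\<Sum>n=1..d. pi_d d n * (ln 2 + Digamma (real n / 2)) - log_mean d * pi_d d n)"
      by (intro sum.cong refl) (simp add: b_def algebra_simps)
    also have "\<dots> = 0"
      unfolding sum_subtractf sum_distrib_left[symmetric] sum_pi_d[OF d] log_mean_def by simp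
    finally show "f' 0 = 0" by simp
    have isT: "isCont (T n) 0" and isD: "isCont (D n) 0"
      and isP: "isCont (\<lambda>z. Polygamma 1 (of_real (real n / 2) + z) :: complex) 0" if n: "n \<in> {1..d}" for n
    proof -
      show "isCont (T n) 0" by (rule DERIV_isCont[OF DT[OF n]]) simp
      show "isCont (D n) 0" by (rule DERIV_isCont[OF DD[OF n]]) simp
      show "isCont (\<lambda>z. Polygamma 1 (of_real (real n / 2) + z) :: complex) 0"
        using nz[OF n, of 0] by (intro isCont_Polygamma continuous_intros) auto
    qed
    show "isCont f'' 0"
      unfolding f''_def by (intro continuous_intros isT isD isP)
  qed simp
  moreover have "f'' 0 / 2 = of_real (2 * s0sq d)"
  proof -
    have "f'' 0 = of_real (\<Sum>n=1..d. pi_d d n * ((b + Digamma (real n / 2))\<^sup>2 + Polygamma 1 (real n / 2)))"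
      unfolding f''_def of_real_sum by (intro sum.cong refl) (simp only: T0 D0 P0, simp)
    then show ?thesis unfolding b_def s0sq_centered[OF d, symmetric] by simp
  qed
  ultimately show "((\<lambda>z. (centered_mix d z - 1) / z\<^sup>2) \<longlongrightarrow> of_real (2 * s0sq d)) (at 0)"
    by (simp add: one)
qed

section \<open>Weak convergence by Levy continuity, and convergence in probability from it\<close>

theorem mainTheorem4:
  fixes x0 :: "real^'d" and \<sigma> :: real
  assumes "\<sigma> > 0" and "x0 \<noteq> 0"
  shows "(\<forall>\<epsilon>>0. (\<lambda>k. measure (R_law 0 \<sigma> x0 k)
                  {r. \<bar>r / real k - mu0 CARD('d) \<sigma>\<bar> > \<epsilon>}) \<longlonglongrightarrow> 0)
       \<and> weak_conv_m
           (\<lambda>k. distr (R_law 0 \<sigma> x0 k) borel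
                   (\<lambda>r. (r - mu0 CARD('d) \<sigma> * real k) / sqrt (real k)))
           (density lborel (normal_density 0 (sqrt (s0sq CARD('d)))))"
proof -
  let ?d = "CARD('d)"
  let ?\<mu> = "mu0 ?d \<sigma>" and ?s = "sqrt (s0sq ?d)"
  let ?R = "\<lambda>k. R_law 0 \<sigma> x0 k"
  let ?Q = "\<lambda>k. distr (?R k) borel (\<lambda>r. (r - ?\<mu> * real k) / sqrt (real k))"
  let ?L = "density lborel (normal_density 0 ?s)"
  define \<phi> where "\<phi> u = logchar u (2 * \<sigma>\<^sup>2) * gamma_mix ?d u / gamma_mix ?d 0" for u
  define \<psi> where "\<psi> u = centered_mix ?d (\<i> * of_real u / 2)" for u :: real
  have s: "s0sq ?d > 0" "?s > 0" using s0sq_pos[of ?d] by auto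
  have \<psi>\<phi>: "\<psi> u = iexp (- (?\<mu> * u)) * \<phi> u" for u
    unfolding \<psi>_def \<phi>_def using assms(1) by (subst centered_mix_conv_gamma_mix) auto
  interpret R: real_distribution "?R k" for k by (rule real_distribution_R_law[OF assms])
  have Q: "real_distribution (?Q k)" for k by (rule R.real_distribution_distr) simp
  have L: "real_distribution ?L" by (rule real_distribution_normal[OF s(2)])
  have charR: "char (?R k) u = iexp (u * ln (norm x0)) * \<phi> u ^ k" for k u
    unfolding \<phi>_def by (rule char_R_law[OF assms])
  \<comment> \<open>For \<open>k = 1\<close> the characteristic function of \<open>R_law\<close> has
    the same modulus as \<open>\<psi> u\<close>, since the remaining factors are unimodular.\<close>
  have le1: "norm (\<psi> u) \<le> 1" for u
    using R.cmod_char_le_1[of 1 u] by (simp add: charR \<psi>\<phi> norm_mult)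
  have \<psi>0: "\<psi> 0 = 1" by (simp add: \<psi>_def centered_mix_second_order)
  \<comment> \<open>At \<open>z = i u / 2\<close> one has
    \<open>z\<^sup>2 = - u\<^sup>2 / 4\<close>; the factor -1/4 converts the limit
    \<open>2 * s0sq\<close> into \<open>- s0sq / 2\<close>.\<close>
  have "((\<lambda>u::real. - (1/4) * ((centered_mix ?d (\<i> * of_real u / 2) - 1) / (\<i> * of_real u / 2)\<^sup>2)) \<longlongrightarrow>
      - (1/4) * of_real (2 * s0sq ?d)) (at 0)"
  proof (intro tendsto_mult tendsto_const filterlim_compose[OF centered_mix_second_order(2)])
    have "((\<lambda>u::real. \<i> * of_real u / 2) \<longlongrightarrow> \<i> * of_real 0 / 2) (at 0)"
      by (intro tendsto_intros) auto
    then show "filterlim (\<lambda>u::real. \<i> * of_real u / 2) (at 0) (at 0)"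
      unfolding filterlim_at by (auto simp: eventually_at_filter)
  qed simp
  moreover have "- (1/4) * ((centered_mix ?d (\<i> * of_real u / 2) - 1) / (\<i> * of_real u / 2)\<^sup>2) = (\<psi> u - 1) / of_real (u\<^sup>2)" for u :: real
    by (cases "u = 0") (simp_all add: \<psi>_def power_divide power_mult_distrib field_simps)
  moreover have "- (1/4) * complex_of_real (2 * s0sq ?d) = of_real (- s0sq ?d / 2)" by simp
  ultimately have lim: "((\<lambda>u. (\<psi> u - 1) / of_real (u\<^sup>2)) \<longlongrightarrow> of_real (- s0sq ?d / 2)) (at 0)"
    by simp
  have weak: "weak_conv_m ?Q ?L"
  proof (rule levy_continuity[OF Q L])
    fix t
    \<comment> \<open>The initial norm enters only through a phase whose argument tends to 0 after
      the scaling, so the limit does not depend on \<open>x0\<close>.\<close>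
    have "(\<lambda>k. t / sqrt (real k)) \<longlonglongrightarrow> 0"
      by (intro tendsto_divide_0[OF tendsto_const] filterlim_at_top_imp_at_infinity
          filterlim_compose[OF sqrt_at_top filterlim_real_sequentially])
    then have "(\<lambda>k. iexp (t / sqrt (real k) * ln (norm x0))) \<longlonglongrightarrow> iexp (0 * ln (norm x0))"
      by (intro tendsto_intros)
    then have "(\<lambda>k. iexp (t / sqrt (real k) * ln (norm x0)) * \<psi> (t / sqrt (real k)) ^ k) \<longlonglongrightarrow>
        iexp (0 * ln (norm x0)) * exp (- of_real (s0sq ?d * t\<^sup>2 / 2))"
      by (intro tendsto_mult tendsto_power_char_limit[OF le1 \<psi>0 lim]) (use s in auto)
    also have "iexp (0 * ln (norm x0)) * exp (- of_real (s0sq ?d * t\<^sup>2 / 2)) = char ?L t"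
      using s by (simp add: char_normal[OF s(2)] power_mult_distrib)
    finally show "(\<lambda>k. char (?Q k) t) \<longlonglongrightarrow> char ?L t"
    proof (rule Lim_transform_eventually)
      show "\<forall>\<^sub>F k in sequentially. iexp (t / sqrt (real k) * ln (norm x0)) * \<psi> (t / sqrt (real k)) ^ k = char (?Q k) t"
        using eventually_gt_at_top[of "0::nat"]
      proof eventually_elim
        case (elim k)
        let ?u = "t / sqrt (real k)"
        have "char (?Q k) t = (\<integral>r. iexp (t * ((r - ?\<mu> * real k) / sqrt (real k))) \<partial>?R k)"
          unfolding char_def by (subst integral_distr) auto
        \<comment> \<open>The centring by \<open>?\<mu> * k\<close> splits into \<open>k\<close>
          equal factors, one for each layer, which turn every \<open>\<phi>\<close> into
          \<open>\<psi>\<close>.\<close>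
        also have "\<dots> = (\<integral>r. iexp (- (?\<mu> * ?u)) ^ k * iexp (?u * r) \<partial>?R k)"
        proof (intro Bochner_Integration.integral_cong refl)
          fix r
          have "t * ((r - ?\<mu> * real k) / sqrt (real k)) = real k * (- (?\<mu> * ?u)) + ?u * r"
            by (simp add: algebra_simps diff_divide_distrib)
          then show "iexp (t * ((r - ?\<mu> * real k) / sqrt (real k))) = iexp (- (?\<mu> * ?u)) ^ k * iexp (?u * r)"
            by (simp only: exp_of_nat_mult[symmetric] exp_add[symmetric]) (simp add: algebra_simps)
        qed
        also have "\<dots> = iexp (- (?\<mu> * ?u)) ^ k * char (?R k) ?u"
          unfolding char_def by (rule Bochner_Integration.integral_mult_right_zero)
        also have "\<dots> = iexp (?u * ln (norm x0)) * \<psi> ?u ^ k"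
          unfolding charR \<psi>\<phi> power_mult_distrib by simp
        finally show ?case ..
      qed
    qed
  qed
  have "(\<lambda>k. measure (?R k) {r. \<bar>r / real k - ?\<mu>\<bar> > \<epsilon>}) \<longlonglongrightarrow> 0" if \<epsilon>: "\<epsilon> > 0" for \<epsilon>
  proof -
    \<comment> \<open>For \<open>k > 0\<close>, a deviation of \<open>r / k\<close> from the mean by
      more than \<open>\<epsilon>\<close> is a deviation of the normalized variable beyond
      \<open>\<epsilon> * sqrt k\<close>, a level that escapes to infinity.\<close>
    have "filterlim (\<lambda>k. \<epsilon> * sqrt (real k)) at_top sequentially"
      by (intro filterlim_tendsto_pos_mult_at_top[OF tendsto_const \<epsilon>]
          filterlim_compose[OF sqrt_at_top filterlim_real_sequentially])
    then have "(\<lambda>k. measure (?Q k) {y. \<bar>y\<bar> > \<epsilon> * sqrt (real k)}) \<longlonglongrightarrow> 0"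
      by (rule tendsto_measure_abs_gt_0[OF Q L weak measure_normal_singleton[OF s(2)]])
    then show ?thesis
    proof (rule Lim_transform_eventually)
      show "\<forall>\<^sub>F k in sequentially. measure (?Q k) {y. \<bar>y\<bar> > \<epsilon> * sqrt (real k)} = measure (?R k) {r. \<bar>r / real k - ?\<mu>\<bar> > \<epsilon>}"
        using eventually_gt_at_top[of "0::nat"]
      proof eventually_elim
        case (elim k)
        then have k: "sqrt (real k) > 0" by simp
        have "\<bar>(r - ?\<mu> * real k) / sqrt (real k)\<bar> > \<epsilon> * sqrt (real k) \<longleftrightarrow> \<bar>r / real k - ?\<mu>\<bar> > \<epsilon>" for r
        proof -
          have "(r - ?\<mu> * real k) / sqrt (real k) = (r / real k - ?\<mu>) * sqrt (real k)"
            using elim by (simp add: field_simps)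
          then have "\<bar>(r - ?\<mu> * real k) / sqrt (real k)\<bar> = \<bar>r / real k - ?\<mu>\<bar> * sqrt (real k)"
            by (simp only: abs_mult abs_of_pos[OF k])
          then show ?thesis using k by simp
        qed
        then show ?case by (subst measure_distr) (auto simp: vimage_def)
      qed
    qed
  qed
  with weak show ?thesis by blast
qed

end
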